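(* Let $m$ be a non-negative integer and $\alpha\in\mathbb{C}$. For $\theta\in(0,\pi)$, $${\rm P}_{-\frac12+\alpha}^{\pm(\frac12+m)}(\cos\theta)=\sqrt{\frac2\pi}\;m!\left[{\rm i}^m\,\Big|\,\frac{{\rm i}^{-m-1}}{(\alpha-m)_{2m+1}}\right]_\pm(\sin\theta)^{-1/2}\left\{{\rm e}^{{\rm i}\alpha\theta}\,P_m^{(\alpha,-\alpha)}({\rm i}\cot\theta)\right\}_{\alpha,\pm},$$ $${\rm Q}_{-\frac12+\alpha}^{\pm(\frac12+m)}(\cos\theta)=\sqrt{\frac\pi2}\;m!\left[{\rm i}^{m+1}\,\Big|\,\frac{{\rm i}^{-m}}{(\alpha-m)_{2m+1}}\right]_\pm(\sin\theta)^{-1/2}\left\{{\rm e}^{{\rm i}\alpha\theta}\,P_m^{(\alpha,-\alpha)}({\rm i}\cot\theta)\right\}_{\alpha,\mp},$$ where ${\rm P}_\nu^\mu,{\rm Q}_\nu^\mu$ are the Ferrers functions of the first and second kinds, $P_m^{(\alpha,\beta)}$ is the Jacobi polynomial, $[A|B]_\pm$ signifies $A$ in the $+$ case and $B$ in the $-$ case, and $\{C\}_{\alpha,+}$, $\{C\}_{\alpha,-}$ are the even and odd parts $\frac12[C(\alpha)\pm C(-\alpha)]$ of $C$ under $\alpha\mapsto-\alpha$. In the sub-cases $\alpha\in\{-m,\dots,m\}$ of the $-$ case, the apparent division by zero in the first formula is handled by interpreting its right-hand side in a limiting sense; but the division by zero in the second formula causes both its sides to be undefined.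
   Context: For $z\in(-1,1)$, ${\rm P}_\nu^\mu(z)=\frac1{\Gamma(1-\mu)}\left(\frac{1+z}{1-z}\right)^{\mu/2}{}_2F_1\!\left(-\nu,\nu+1;1-\mu;\frac{1-z}2\right)$ with ${}_2F_1$ the Gauss function, and for $\mu\notin\mathbb{Z}$ the second-kind Ferrers function is $${\rm Q}_\nu^\mu=\frac\pi2\left[\cot(\mu\pi)\,{\rm P}_\nu^\mu-\csc(\mu\pi)\,\frac{\Gamma(\nu+\mu+1)}{\Gamma(\nu-\mu+1)}\,{\rm P}_\nu^{-\mu}\right],$$ where the gamma quotient is understood as a limit (in $\nu$) whenever that limit is finite. $(\alpha-m)_{2m+1}=(\alpha-m)(\alpha-m+1)\cdots(\alpha+m)$. The Jacobi polynomials, for arbitrary complex $\alpha,\beta$, are the polynomials given by $P_n^{(\alpha,\beta)}(z)=\frac{(-1)^n}{2^nn!}(1-z)^{-\alpha}(1+z)^{-\beta}\frac{{\rm d}^n}{{\rm d}z^n}\left[(1-z)^{\alpha+n}(1+z)^{\beta+n}\right]$, evaluated also at complex arguments. *)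

theory Defs
  imports "HOL-Analysis.Analysis" "HOL-Computational_Algebra.Computational_Algebra"
begin

(* The Gauss series; meaningful for norm z < 1 and c not in {0, -1, -2, ...}. *)
definition gauss_2F1 :: "complex \<Rightarrow> complex \<Rightarrow> complex \<Rightarrow> complex \<Rightarrow> complex" where
  "gauss_2F1 a b c z = eval_fps (fps_hypergeo [a, b] [c] 1) z"

(* Ferrers function of the first kind, for -1 < z < 1.  For \<mu> = 1, 2, 3, ... the usual reading
   is as a limit in \<mu>, which this formula does not incorporate. *)
definition Ferrers_P :: "complex \<Rightarrow> complex \<Rightarrow> real \<Rightarrow> complex" where
  "Ferrers_P \<nu> \<mu> z =
     1 / Gamma (1 - \<mu>) * of_real ((1 + z) / (1 - z)) powr (\<mu> / 2) *
     gauss_2F1 (- \<nu>) (\<nu> + 1) (1 - \<mu>) (of_real ((1 - z) / 2))"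

definition Ferrers_Q_defined :: "complex \<Rightarrow> complex \<Rightarrow> bool" where
  "Ferrers_Q_defined \<nu> \<mu> \<longleftrightarrow>
     \<mu> \<notin> \<int> \<and> (\<exists>L. ((\<lambda>n. Gamma (n + \<mu> + 1) / Gamma (n - \<mu> + 1)) \<longlongrightarrow> L) (at \<nu>))"

(* Ferrers function of the second kind, for -1 < z < 1.  The value is meaningful only when
   Ferrers_Q_defined \<nu> \<mu> holds.  The gamma quotient is taken as a limit in the degree, which
   agrees with the plain quotient unless \<nu> + \<mu> + 1 is a pole of Gamma. *)
definition Ferrers_Q :: "complex \<Rightarrow> complex \<Rightarrow> real \<Rightarrow> complex" where
  "Ferrers_Q \<nu> \<mu> z =
     of_real pi / 2 *
       (cot (\<mu> * of_real pi) * Ferrers_P \<nu> \<mu> z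
        - 1 / sin (\<mu> * of_real pi)
          * Lim (at \<nu>) (\<lambda>n. Gamma (n + \<mu> + 1) / Gamma (n - \<mu> + 1))
          * Ferrers_P \<nu> (- \<mu>) z)"

(* The polynomial given by Rodrigues' formula.  On the unit disc 1 - z and 1 + z have positive
   real part, so all powers are principal-branch holomorphic functions; the polynomial is
   determined by its values there and can then be evaluated at any complex argument. *)
definition Jacobi_poly :: "nat \<Rightarrow> complex \<Rightarrow> complex \<Rightarrow> complex poly" where
  "Jacobi_poly n \<alpha> \<beta> = (THE p. \<forall>z. norm z < 1 \<longrightarrow>
     poly p z = (-1) ^ n / (2 ^ n * fact n) * (1 - z) powr (- \<alpha>) * (1 + z) powr (- \<beta>) *
       (deriv ^^ n) (\<lambda>w. (1 - w) powr (\<alpha> + of_nat n) * (1 + w) powr (\<beta> + of_nat n)) z)"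

definition even_part :: "(complex \<Rightarrow> complex) \<Rightarrow> complex \<Rightarrow> complex" where
  "even_part C \<alpha> = 1 / 2 * (C \<alpha> + C (- \<alpha>))"

definition odd_part :: "(complex \<Rightarrow> complex) \<Rightarrow> complex \<Rightarrow> complex" where
  "odd_part C \<alpha> = 1 / 2 * (C \<alpha> - C (- \<alpha>))"

end

theory Submission
  imports Defs "HOL-Complex_Analysis.Cauchy_Integral_Formula"
begin

text \<open>
  The proof is an induction on \<open>m\<close> in which every step is a first-order differential relation in
  \<open>\<theta>\<close>.  Rodrigues' formula gives \<open>(n + 1) P\<^sub>n\<^sub>+\<^sub>1 = (\<alpha> + (n + 1) z) P\<^sub>n - (1 - z\<^sup>2) P\<^sub>n'\<close> for
  \<open>P\<^sub>n = P\<^sub>n\<^sup>(\<^sup>\<alpha>\<^sup>,\<^sup>-\<^sup>\<alpha>\<^sup>)\<close>.  At \<open>z = \<i> cot \<theta>\<close> one has \<open>(1 - z\<^sup>2) d/dz = \<i> d/d\<theta>\<close>, so that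
  \<open>C\<^sub>n = exp (\<i>\<alpha>\<theta>) P\<^sub>n (\<i> cot \<theta>)\<close> satisfies \<open>(n + 1) C\<^sub>n\<^sub>+\<^sub>1 = \<i> ((n + 1) cot \<theta> C\<^sub>n - C\<^sub>n')\<close>.  Since
  \<open>\<alpha>\<close> no longer occurs, the even and the odd part obey the same relation.  The contiguous relations
  of Gauss's series that shift only the third parameter give \<open>(sin \<theta>)\<^sup>1\<^sup>/\<^sup>2\<close> times the Ferrers
  function of order \<open>\<plusminus>(m + 1/2)\<close> the same ladder, and for \<open>m = 0\<close> both sides are multiples of
  \<open>cos (\<alpha>\<theta>)\<close> and \<open>sin (\<alpha>\<theta>)\<close>.  Multiplying order \<open>-(m + 1/2)\<close> by \<open>(\<alpha> - m)\<^sub>2\<^sub>m\<^sub>+\<^sub>1\<close>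
  keeps the identity valid at the exceptional \<open>\<alpha>\<close>, where the limit follows from continuity of Gauss's series
  in its parameters.  As \<open>cot (\<mu>\<pi>) = 0\<close>, \<open>Q\<close> is a multiple of \<open>P\<close> of opposite order.
\<close>

subsection \<open>Gauss's series and its contiguous relations\<close>

lemma tendsto_shifted_ratio:
  "(\<lambda>n. (a + of_nat n) / (b + of_nat n) :: complex) \<longlonglongrightarrow> 1"
proof -
  have "(\<lambda>n. (a * inverse (of_nat n) + 1) / (b * inverse (of_nat n) + 1) :: complex)
      \<longlonglongrightarrow> (a * 0 + 1) / (b * 0 + 1)"
    by (intro tendsto_intros lim_inverse_n) auto
  moreover have "eventually (\<lambda>n. (a * inverse (of_nat n) + 1) / (b * inverse (of_nat n) + 1)
      = (a + of_nat n) / (b + of_nat n)) sequentially"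
    using eventually_gt_at_top[of 0]
  proof eventually_elim
    case (elim n)
    then have "(a * inverse (of_nat n) + 1) * of_nat n = a + of_nat n"
      "(b * inverse (of_nat n) + 1) * of_nat n = b + of_nat n"
      by (simp_all add: algebra_simps)
    then show ?case
      using elim by (metis mult_divide_mult_cancel_right of_nat_eq_0_iff less_numeral_extra(3))
  qed
  ultimately show ?thesis
    by (simp add: filterlim_cong)
qed

text \<open>When c + k = 0 for some k \<le> n, both sides are zero under the convention x / 0 =
  0.\<close>

lemma gauss_series_Suc:
  "fps_nth (fps_hypergeo [a, b] [c] 1) (Suc n)
    = (a + of_nat n) * (b + of_nat n) / ((of_nat n + 1) * (c + of_nat n)) * fps_nth (fps_hypergeo [a, b] [c] 1) n"
  for a b c :: complex
  by (subst fps_hypergeo_rec) (simp add: add.commute)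

text \<open>Ratio test: consecutive coefficients have a quotient tending to 1. Only a lower bound is
  claimed, since a terminating series has infinite radius.\<close>

lemma fps_conv_radius_gauss: "fps_conv_radius (fps_hypergeo [a, b] [c] (1 :: complex)) \<ge> 1"
  unfolding fps_conv_radius_def
proof (rule conv_radius_geI_ex')
  fix r :: real assume r: "0 < r" "ereal r < 1"
  let ?t = "fps_nth (fps_hypergeo [a, b] [c] (1 :: complex))"
  let ?q = "\<lambda>n. (a + of_nat n) * (b + of_nat n) / ((of_nat n + 1) * (c + of_nat n)) :: complex"
  have "(\<lambda>n. norm ((a + of_nat n) / (1 + of_nat n) * ((b + of_nat n) / (c + of_nat n))) * r)
      \<longlonglongrightarrow> norm (1 * 1 :: complex) * r"
    by (intro tendsto_intros tendsto_shifted_ratio)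
  then have lim: "(\<lambda>n. norm (?q n) * r) \<longlonglongrightarrow> r"
    by (simp add: add.commute)
  \<comment> \<open>The contraction factor (r + 1) / 2 is placed strictly between the limiting ratio
    r and 1.\<close>
  have "r < (r + 1) / 2" and lt1: "(r + 1) / 2 < 1"
    using r by auto
  from order_tendstoD(2)[OF lim this(1)] obtain N
    where N: "\<And>n. n \<ge> N \<Longrightarrow> norm (?q n) * r < (r + 1) / 2"
    by (auto simp: eventually_at_top_linorder)
  show "summable (\<lambda>n. ?t n * of_real r ^ n)"
  proof (rule summable_ratio_test[OF lt1])
    fix n assume "n \<ge> N"
    have "norm (?t (Suc n) * of_real r ^ Suc n) = (norm (?q n) * r) * norm (?t n * of_real r ^ n)"
      using r by (subst gauss_series_Suc) (simp only: norm_mult power_Suc norm_of_real, simp)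
    also have "\<dots> \<le> (r + 1) / 2 * norm (?t n * of_real r ^ n)"
      using N[OF \<open>n \<ge> N\<close>] by (intro mult_right_mono) auto
    finally show "norm (?t (Suc n) * of_real r ^ Suc n) \<le> (r + 1) / 2 * norm (?t n * of_real r ^ n)" .
  qed
qed

lemma norm_less_fps_conv_radius_gauss:
  "norm z < 1 \<Longrightarrow> ereal (norm z) < fps_conv_radius (fps_hypergeo [a, b] [c] (1 :: complex))"
  using fps_conv_radius_gauss[of a b c]
  by (metis ereal_less(3) less_le_trans)

lemma gauss_2F1_0 [simp]: "gauss_2F1 a b c 0 = 1"
  by (simp add: gauss_2F1_def eval_fps_at_0)

text \<open>Kept as the termwise differentiated series rather than as a Gauss series with all
  parameters raised by one, so that the contiguous relations below can hold a and b fixed.\<close>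

definition gauss_2F1_deriv :: "complex \<Rightarrow> complex \<Rightarrow> complex \<Rightarrow> complex \<Rightarrow> complex" where
  "gauss_2F1_deriv a b c z = eval_fps (fps_deriv (fps_hypergeo [a, b] [c] 1)) z"

lemma has_field_derivative_gauss_2F1:
  assumes "norm z < 1"
  shows "(gauss_2F1 a b c has_field_derivative gauss_2F1_deriv a b c z) (at z within A)"
  unfolding gauss_2F1_def[abs_def] gauss_2F1_deriv_def
  by (rule has_field_derivative_eval_fps[OF norm_less_fps_conv_radius_gauss[OF assms]])

lemma gauss_2F1_sums:
  assumes "norm z < 1"
  shows "(\<lambda>n. fps_nth (fps_hypergeo [a, b] [c] 1) n * z ^ n) sums gauss_2F1 a b c z"
  unfolding gauss_2F1_def by (rule sums_eval_fps[OF norm_less_fps_conv_radius_gauss[OF assms]])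

lemma gauss_2F1_deriv_sums:
  assumes "norm z < 1"
  shows "(\<lambda>n. of_nat (Suc n) * fps_nth (fps_hypergeo [a, b] [c] 1) (Suc n) * z ^ n)
    sums gauss_2F1_deriv a b c z"
proof -
  have "ereal (norm z) < fps_conv_radius (fps_deriv (fps_hypergeo [a, b] [c] (1 :: complex)))"
    using norm_less_fps_conv_radius_gauss[OF assms] fps_conv_radius_deriv by (rule less_le_trans)
  from sums_eval_fps[OF this] show ?thesis
    by (simp add: gauss_2F1_deriv_def del: fps_hypergeo_nth of_nat_Suc)
qed

text \<open>The Euler operator z d/dz multiplies the n-th coefficient by n; the index shift is
  harmless because the term n = 0 vanishes.\<close>

lemma z_gauss_2F1_deriv_sums:
  assumes "norm z < 1"
  shows "(\<lambda>n. of_nat n * fps_nth (fps_hypergeo [a, b] [c] 1) n * z ^ n)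
    sums (z * gauss_2F1_deriv a b c z)"
proof -
  have "(\<lambda>n. z * (of_nat (Suc n) * fps_nth (fps_hypergeo [a, b] [c] 1) (Suc n) * z ^ n))
      sums (z * gauss_2F1_deriv a b c z)"
    by (intro sums_mult gauss_2F1_deriv_sums assms)
  then have "(\<lambda>n. of_nat (Suc n) * fps_nth (fps_hypergeo [a, b] [c] 1) (Suc n) * z ^ Suc n)
      sums (z * gauss_2F1_deriv a b c z)"
    by (simp only: power_Suc mult_ac)
  then show ?thesis
    by (subst (asm) sums_Suc_iff) simp
qed

text \<open>This is (c)_n (c + n) = c (c + 1)_n divided by both symbols. Together the two hypotheses
  exclude exactly c = 0, -1, -2, ...\<close>

lemma gauss_series_lower:
  assumes "c + 1 \<notin> \<int>\<^sub>\<le>\<^sub>0" "c \<noteq> 0"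
  shows "c * fps_nth (fps_hypergeo [a, b] [c] 1) n
    = (c + of_nat n) * fps_nth (fps_hypergeo [a, b] [c + 1] (1 :: complex)) n"
proof -
  have "pochhammer c n * (c + of_nat n) = c * pochhammer (c + 1) n"
    by (metis pochhammer_rec pochhammer_rec' mult.commute)
  moreover have "pochhammer (c + 1) n \<noteq> 0"
    using assms(1) pochhammer_eq_0_imp_nonpos_Int by blast
  moreover from this have "c + of_nat n \<noteq> 0 \<Longrightarrow> pochhammer c n \<noteq> 0"
    using assms(2) calculation(1) by auto
  moreover have "c + of_nat n \<noteq> 0"
  proof (cases n)
    case (Suc k)
    show ?thesis
    proof
      assume "c + of_nat n = 0"
      then have "c + 1 = - of_nat k"
        using Suc by (simp add: eq_neg_iff_add_eq_0 add_ac)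
      with assms(1) show False by simp
    qed
  qed (use assms(2) in simp)
  ultimately show ?thesis
    by (simp add: divide_simps) (simp add: mult_ac)
qed

text \<open>The operator c + z d/dz multiplies the n-th coefficient by c + n, which is the factor in
  \<open>gauss_series_lower\<close>.\<close>

lemma gauss_2F1_lower:
  assumes "norm z < 1" "c + 1 \<notin> \<int>\<^sub>\<le>\<^sub>0" "c \<noteq> 0"
  shows "c * gauss_2F1 a b c z = c * gauss_2F1 a b (c + 1) z + z * gauss_2F1_deriv a b (c + 1) z"
proof (rule sums_unique2)
  show "(\<lambda>n. c * (fps_nth (fps_hypergeo [a, b] [c] 1) n * z ^ n)) sums (c * gauss_2F1 a b c z)"
    by (intro sums_mult gauss_2F1_sums assms)
  have "(\<lambda>n. c * (fps_nth (fps_hypergeo [a, b] [c + 1] 1) n * z ^ n)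
      + of_nat n * fps_nth (fps_hypergeo [a, b] [c + 1] 1) n * z ^ n)
    sums (c * gauss_2F1 a b (c + 1) z + z * gauss_2F1_deriv a b (c + 1) z)"
    by (intro sums_add sums_mult gauss_2F1_sums z_gauss_2F1_deriv_sums assms)
  moreover have "c * (fps_nth (fps_hypergeo [a, b] [c + 1] 1) n * z ^ n)
      + of_nat n * fps_nth (fps_hypergeo [a, b] [c + 1] 1) n * z ^ n
    = c * (fps_nth (fps_hypergeo [a, b] [c] 1) n * z ^ n)" for n
    using gauss_series_lower[OF assms(2,3), of a b n]
    by (simp only: mult.assoc[symmetric]) (simp only: distrib_right)
  ultimately show "(\<lambda>n. c * (fps_nth (fps_hypergeo [a, b] [c] 1) n * z ^ n))
    sums (c * gauss_2F1 a b (c + 1) z + z * gauss_2F1_deriv a b (c + 1) z)"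
    by simp
qed

text \<open>Coefficientwise, the recurrence in n and \<open>gauss_series_lower\<close> reduce this
  to (a + n)(b + n) + (c + n)(c - a - b - n) = (c - a)(c - b), whose right-hand side is free of
  n.\<close>

lemma gauss_2F1_raise:
  assumes "norm z < 1" "c \<notin> \<int>\<^sub>\<le>\<^sub>0"
  shows "c * ((1 - z) * gauss_2F1_deriv a b c z + (c - a - b) * gauss_2F1 a b c z)
    = (c - a) * (c - b) * gauss_2F1 a b (c + 1) z"
proof (rule sums_unique2)
  let ?t = "fps_nth (fps_hypergeo [a, b] [c] 1)"
  let ?u = "fps_nth (fps_hypergeo [a, b] [c + 1] 1)"
  show "(\<lambda>n. (c - a) * (c - b) * (?u n * z ^ n)) sums ((c - a) * (c - b) * gauss_2F1 a b (c + 1) z)"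
    by (intro sums_mult gauss_2F1_sums assms)
  have "(\<lambda>n. c * ((of_nat (Suc n) * ?t (Suc n) * z ^ n - of_nat n * ?t n * z ^ n)
      + (c - a - b) * (?t n * z ^ n)))
    sums (c * ((gauss_2F1_deriv a b c z - z * gauss_2F1_deriv a b c z)
      + (c - a - b) * gauss_2F1 a b c z))"
    by (intro sums_mult sums_add sums_diff gauss_2F1_sums z_gauss_2F1_deriv_sums
        gauss_2F1_deriv_sums assms)
  moreover have "c * ((of_nat (Suc n) * ?t (Suc n) * z ^ n - of_nat n * ?t n * z ^ n)
      + (c - a - b) * (?t n * z ^ n)) = (c - a) * (c - b) * (?u n * z ^ n)" for n
  proof -
    have c0: "c \<noteq> 0" and cn: "c + of_nat n \<noteq> 0" for n
    proof -
      show "c + of_nat n \<noteq> 0"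
        using assms(2) by (metis add_eq_0_iff2 minus_of_nat_in_nonpos_Ints)
      show "c \<noteq> 0"
        using assms(2) by auto
    qed
    have c1: "c + 1 \<notin> \<int>\<^sub>\<le>\<^sub>0"
      using assms(2) by (metis add_diff_cancel_right' nonpos_Ints_diff_Nats Nats_1)
    have u: "c * ?t n = (c + of_nat n) * ?u n"
      by (rule gauss_series_lower[OF c1 c0])
    have "of_nat (Suc n) * ?t (Suc n) * (c + of_nat n) = (a + of_nat n) * (b + of_nat n) * ?t n"
      using cn[of n] of_nat_neq_0[of n, where ?'a = complex]
      by (subst gauss_series_Suc) (simp add: divide_simps add.commute del: fps_hypergeo_nth)
    then have "(c + of_nat n) * (c * (of_nat (Suc n) * ?t (Suc n) - of_nat n * ?t n
        + (c - a - b) * ?t n))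
      = ((a + of_nat n) * (b + of_nat n) + (c + of_nat n) * (c - a - b - of_nat n)) * (c * ?t n)"
      by algebra
    also have "\<dots> = (c + of_nat n) * ((c - a) * (c - b) * ?u n)"
      unfolding u by algebra
    finally have "c * (of_nat (Suc n) * ?t (Suc n) - of_nat n * ?t n + (c - a - b) * ?t n)
        = (c - a) * (c - b) * ?u n"
      using cn[of n] mult_left_cancel by blast
    \<comment> \<open>Restores the factor z^n; fresh variables make the rearrangement a plain
      polynomial identity.\<close>
    moreover have "c * (N' * T' - N * T + d * T) = k * U
        \<Longrightarrow> c * ((N' * T' * Z - N * T * Z) + d * (T * Z)) = k * (U * Z)"
      for N' T' N T d k U Z :: complex
      by algebra
    ultimately show ?thesis
      by blast
  qed
  ultimately have "(\<lambda>n. (c - a) * (c - b) * (?u n * z ^ n))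
    sums (c * ((gauss_2F1_deriv a b c z - z * gauss_2F1_deriv a b c z)
      + (c - a - b) * gauss_2F1 a b c z))"
    by simp
  then show "(\<lambda>n. (c - a) * (c - b) * (?u n * z ^ n))
      sums (c * ((1 - z) * gauss_2F1_deriv a b c z + (c - a - b) * gauss_2F1 a b c z))"
    by (simp add: left_diff_distrib)
qed

subsection \<open>Jacobi polynomials with opposite parameters\<close>

text \<open>A concrete polynomial that will serve as the witness for the definite description in
  \<open>Jacobi_poly\<close>, at second parameter -\<alpha>.\<close>

fun jacobi_rec :: "nat \<Rightarrow> complex \<Rightarrow> complex poly" where
  "jacobi_rec 0 \<alpha> = 1"
| "jacobi_rec (Suc n) \<alpha> = smult (1 / of_nat (Suc n))
     ([:\<alpha>, of_nat (Suc n):] * jacobi_rec n \<alpha> - [:1, 0, -1:] * pderiv (jacobi_rec n \<alpha>))"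

text \<open>Leibniz' rule stops after two terms because the second derivative of w vanishes. For n =
  0 the truncated index \<open>n - 1\<close> is harmless, as its coefficient is 0.\<close>

lemma higher_deriv_ident_mult:
  fixes f :: "complex \<Rightarrow> complex"
  assumes "f holomorphic_on S" "open S" "z \<in> S"
  shows "(deriv ^^ n) (\<lambda>w. w * f w) z = z * (deriv ^^ n) f z + of_nat n * (deriv ^^ (n - 1)) f z"
  using assms(3)
proof (induction n arbitrary: z)
  case (Suc n)
  have d: "((deriv ^^ k) f has_field_derivative (deriv ^^ Suc k) f z) (at z)" for k
    using has_field_derivative_higher_deriv[OF assms(1,2) Suc.prems] by simp
  have "((\<lambda>w. w * (deriv ^^ n) f w + of_nat n * (deriv ^^ (n - 1)) f w) has_field_derivative
      1 * (deriv ^^ n) f z + (deriv ^^ Suc n) f z * z + of_nat n * (deriv ^^ Suc (n - 1)) f z) (at z)"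
    by (intro derivative_intros DERIV_cmult DERIV_mult DERIV_add d)
  then have "((deriv ^^ n) (\<lambda>w. w * f w) has_field_derivative
      1 * (deriv ^^ n) f z + (deriv ^^ Suc n) f z * z + of_nat n * (deriv ^^ Suc (n - 1)) f z) (at z)"
    by (rule has_field_derivative_transform_within_open[OF _ assms(2) Suc.prems])
      (simp add: Suc.IH)
  then have "(deriv ^^ Suc n) (\<lambda>w. w * f w) z
      = 1 * (deriv ^^ n) f z + (deriv ^^ Suc n) f z * z + of_nat n * (deriv ^^ Suc (n - 1)) f z"
    using DERIV_imp_deriv by simp
  then show ?case
    by (cases n) (simp_all add: algebra_simps)
qed simp

lemma one_plus_minus_nonpos:
  fixes z :: complex
  assumes "norm z < 1"
  shows "1 - z \<notin> \<real>\<^sub>\<le>\<^sub>0" "1 + z \<notin> \<real>\<^sub>\<le>\<^sub>0"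
proof -
  have "\<bar>Re z\<bar> < 1"
    using abs_Re_le_cmod[of z] assms by linarith
  then show "1 - z \<notin> \<real>\<^sub>\<le>\<^sub>0" "1 + z \<notin> \<real>\<^sub>\<le>\<^sub>0"
    by (auto simp: complex_nonpos_Reals_iff)
qed

text \<open>Both exponents are lowered by one, so that differentiating the weight of index n + 1
  produces a multiple of the weight of index n.\<close>

lemma has_field_derivative_jacobi_weight:
  fixes z :: complex
  assumes "norm z < 1"
  shows "((\<lambda>w. (1 - w) powr a * (1 + w) powr b) has_field_derivative
      (b * (1 - z) - a * (1 + z)) * ((1 - z) powr (a - 1) * (1 + z) powr (b - 1))) (at z)"
proof -
  have nz: "1 - z \<noteq> 0" "1 + z \<noteq> 0"
    using one_plus_minus_nonpos[OF assms] by auto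
  then have p: "(1 - z) powr a = (1 - z) * (1 - z) powr (a - 1)"
    "(1 + z) powr b = (1 + z) * (1 + z) powr (b - 1)"
    by (simp_all add: powr_diff)
  have "((\<lambda>w. (1 - w) powr a * (1 + w) powr b) has_field_derivative
      (a * (1 - z) powr (a - 1) * (0 - 1)) * (1 + z) powr b
      + (b * (1 + z) powr (b - 1) * (0 + 1)) * (1 - z) powr a) (at z)"
    by (intro DERIV_mult DERIV_chain2[OF has_field_derivative_powr] derivative_intros
        one_plus_minus_nonpos assms)
  moreover have "(a * (1 - z) powr (a - 1) * (0 - 1)) * (1 + z) powr b
      + (b * (1 + z) powr (b - 1) * (0 + 1)) * (1 - z) powr a
    = (b * (1 - z) - a * (1 + z)) * ((1 - z) powr (a - 1) * (1 + z) powr (b - 1))"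
    unfolding p by algebra
  ultimately show ?thesis
    by simp
qed

lemma holomorphic_jacobi_weight:
  "(\<lambda>w. (1 - w) powr a * (1 + w) powr b) holomorphic_on ball 0 1" for a b :: complex
  unfolding holomorphic_on_def field_differentiable_def
  by (auto intro!: exI has_field_derivative_at_within[OF has_field_derivative_jacobi_weight])

text \<open>Leibniz' rule for both \<open>W\<^sub>n\<^sub>+\<^sub>1 = (1 - z\<^sup>2) W\<^sub>n\<close> and
  \<open>W\<^sub>n\<^sub>+\<^sub>1' = (-2\<alpha> - 2(n + 1)z) W\<^sub>n\<close>; the derivative of order \<open>n - 1\<close> is eliminated between the two.\<close>
lemma rodrigues_weight_step:
  fixes \<alpha> :: complex
  defines "W \<equiv> \<lambda>n w. (1 - w) powr (\<alpha> + of_nat n) * (1 + w) powr (- \<alpha> + of_nat n)"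
  assumes z: "norm z < 1"
  shows "(deriv ^^ Suc n) (W (Suc n)) z = 2 * (1 - z\<^sup>2) * (deriv ^^ Suc n) (W n) z
      + (2 * \<alpha> - 2 * of_nat (Suc n) * z) * (deriv ^^ n) (W n) z"
proof -
  let ?B = "ball (0 :: complex) 1"
  have zB: "z \<in> ?B"
    using z by simp
  have hW [holomorphic_intros]: "W k holomorphic_on ?B" for k
    unfolding W_def by (rule holomorphic_jacobi_weight)
  have nz: "1 - w \<noteq> 0" "1 + w \<noteq> 0" if "w \<in> ?B" for w
    using one_plus_minus_nonpos[of w] that by auto
  have p: "x powr (e + of_nat (Suc n)) = x * x powr (e + of_nat n)" if "x \<noteq> 0" for x e :: complex
  proof -
    have "x powr (e + of_nat (Suc n)) = x powr ((e + of_nat n) + 1)"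
      by (simp add: add_ac)
    then show ?thesis
      using that by (simp only: powr_add) (simp add: mult.commute)
  qed
  \<comment> \<open>The factor 1 - w^2 is written with nested multiplications by w, ready for two
    applications of \<open>higher_deriv_ident_mult\<close>.\<close>
  have W_Suc: "W (Suc n) w = W n w - w * (w * W n w)" if "w \<in> ?B" for w
  proof -
    have "W (Suc n) w = ((1 - w) * (1 - w) powr (\<alpha> + of_nat n)) * ((1 + w) * (1 + w) powr (- \<alpha> + of_nat n))"
      using nz[OF that] by (simp only: W_def p[OF nz(1)[OF that]] p[OF nz(2)[OF that]])
    then show ?thesis
      unfolding W_def by algebra
  qed
  have dW_Suc: "deriv (W (Suc n)) w = - 2 * \<alpha> * W n w - 2 * of_nat (Suc n) * (w * W n w)"
    if "w \<in> ?B" for w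
  proof -
    have "deriv (W (Suc n)) w
      = ((- \<alpha> + of_nat (Suc n)) * (1 - w) - (\<alpha> + of_nat (Suc n)) * (1 + w))
        * ((1 - w) powr (\<alpha> + of_nat (Suc n) - 1) * (1 + w) powr (- \<alpha> + of_nat (Suc n) - 1))"
      unfolding W_def using that by (intro DERIV_imp_deriv has_field_derivative_jacobi_weight) simp
    also have "\<dots> = ((- \<alpha> + of_nat (Suc n)) * (1 - w) - (\<alpha> + of_nat (Suc n)) * (1 + w)) * W n w"
      by (simp add: W_def)
    finally show ?thesis
      by algebra
  qed
  have dz: "(deriv ^^ k) (\<lambda>w. w * W n w) z = z * (deriv ^^ k) (W n) z + of_nat k * (deriv ^^ (k - 1)) (W n) z" for k
    by (intro higher_deriv_ident_mult[of _ ?B] hW zB open_ball)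
  have "(deriv ^^ Suc n) (W (Suc n)) z = (deriv ^^ Suc n) (\<lambda>w. W n w - w * (w * W n w)) z"
    by (intro higher_deriv_transform_within_open[of _ ?B] holomorphic_intros open_ball zB W_Suc)
  also have "\<dots> = (deriv ^^ Suc n) (W n) z - (deriv ^^ Suc n) (\<lambda>w. w * (w * W n w)) z"
    by (intro higher_deriv_diff[of _ ?B] holomorphic_intros open_ball zB)
  also have "(deriv ^^ Suc n) (\<lambda>w. w * (w * W n w)) z
      = z * (deriv ^^ Suc n) (\<lambda>w. w * W n w) z + of_nat (Suc n) * (deriv ^^ n) (\<lambda>w. w * W n w) z"
    by (subst higher_deriv_ident_mult[of _ ?B]) (auto intro!: holomorphic_intros simp: z)
  finally have 1: "(deriv ^^ Suc n) (W (Suc n)) z = (deriv ^^ Suc n) (W n) z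
      - z * (z * (deriv ^^ Suc n) (W n) z + of_nat (Suc n) * (deriv ^^ n) (W n) z)
      - of_nat (Suc n) * (z * (deriv ^^ n) (W n) z + of_nat n * (deriv ^^ (n - 1)) (W n) z)"
    unfolding dz by simp
  have "(deriv ^^ Suc n) (W (Suc n)) z = (deriv ^^ n) (deriv (W (Suc n))) z"
    by (simp only: funpow_Suc_right o_apply)
  also have "\<dots> = (deriv ^^ n) (\<lambda>w. - 2 * \<alpha> * W n w - 2 * of_nat (Suc n) * (w * W n w)) z"
    by (intro higher_deriv_transform_within_open[of _ ?B] holomorphic_intros open_ball zB dW_Suc)
  also have "\<dots> = (deriv ^^ n) (\<lambda>w. - 2 * \<alpha> * W n w) z - (deriv ^^ n) (\<lambda>w. 2 * of_nat (Suc n) * (w * W n w)) z"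
    by (intro higher_deriv_diff[of _ ?B] holomorphic_intros open_ball zB)
  also have "(deriv ^^ n) (\<lambda>w. - 2 * \<alpha> * W n w) z = - 2 * \<alpha> * (deriv ^^ n) (W n) z"
    by (intro higher_deriv_cmult[of _ ?B] holomorphic_intros open_ball zB)
  also have "(deriv ^^ n) (\<lambda>w. 2 * of_nat (Suc n) * (w * W n w)) z
      = 2 * of_nat (Suc n) * (deriv ^^ n) (\<lambda>w. w * W n w) z"
    by (intro higher_deriv_cmult[of _ ?B] holomorphic_intros open_ball zB)
  finally have 2: "(deriv ^^ Suc n) (W (Suc n)) z = - 2 * \<alpha> * (deriv ^^ n) (W n) z
      - 2 * of_nat (Suc n) * (z * (deriv ^^ n) (W n) z + of_nat n * (deriv ^^ (n - 1)) (W n) z)"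
    unfolding dz .
  \<comment> \<open>Twice the first expression minus the second cancels the derivative of order n -
    1.\<close>
  show ?thesis
    using 1 2 by algebra
qed

text \<open>Differentiating the induction hypothesis once gives the derivative of order n + 1 of the
  n-th weight; \<open>rodrigues_weight_step\<close> then passes to the next weight, and the outcome
  is the recurrence of \<open>jacobi_rec\<close>. The constant (-2)^n n! is the reciprocal of the
  normalisation in Rodrigues' formula.\<close>

lemma rodrigues_jacobi_rec:
  fixes z :: complex
  assumes "norm z < 1"
  shows "(deriv ^^ n) (\<lambda>w. (1 - w) powr (\<alpha> + of_nat n) * (1 + w) powr (- \<alpha> + of_nat n)) z
    = (-2) ^ n * fact n * (1 - z) powr \<alpha> * (1 + z) powr (- \<alpha>) * poly (jacobi_rec n \<alpha>) z"
  using assms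
proof (induction n arbitrary: z)
  case (Suc n)
  let ?W = "\<lambda>n w. (1 - w) powr (\<alpha> + of_nat n) * (1 + w) powr (- \<alpha> + of_nat n)"
  let ?w = "\<lambda>z. (1 - z) powr \<alpha> * (1 + z) powr (- \<alpha>)"
  let ?K = "(-2) ^ n * fact n :: complex"
  have nz: "1 - z \<noteq> 0" "1 + z \<noteq> 0"
    using one_plus_minus_nonpos[OF Suc.prems] by auto
  \<comment> \<open>The derivative of the weight is -2 \<alpha> w'; multiplying by 1 - z^2 brings
    back the weight itself.\<close>
  define w' where "w' = (1 - z) powr (\<alpha> - 1) * (1 + z) powr (- \<alpha> - 1)"
  have w: "(1 - z\<^sup>2) * w' = ?w z"
  proof -
    have "?w z = ((1 - z) * (1 - z) powr (\<alpha> - 1)) * ((1 + z) * (1 + z) powr (- \<alpha> - 1))"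
      using nz by (simp add: powr_diff)
    then show ?thesis
      unfolding w'_def by algebra
  qed
  have "((\<lambda>z. ?K * (?w z * poly (jacobi_rec n \<alpha>) z)) has_field_derivative
      ?K * ((- \<alpha> * (1 - z) - \<alpha> * (1 + z)) * w' * poly (jacobi_rec n \<alpha>) z
        + poly (pderiv (jacobi_rec n \<alpha>)) z * ?w z)) (at z)"
    unfolding w'_def
    by (intro DERIV_cmult DERIV_mult has_field_derivative_jacobi_weight poly_DERIV Suc.prems)
  then have "((deriv ^^ n) (?W n) has_field_derivative
      ?K * ((- \<alpha> * (1 - z) - \<alpha> * (1 + z)) * w' * poly (jacobi_rec n \<alpha>) z
        + poly (pderiv (jacobi_rec n \<alpha>)) z * ?w z)) (at z)"
    by (rule has_field_derivative_transform_within_open[of _ _ _ "ball 0 1"])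
      (use Suc in \<open>auto simp: mult_ac\<close>)
  then have d: "(deriv ^^ Suc n) (?W n) z = 
      ?K * ((- \<alpha> * (1 - z) - \<alpha> * (1 + z)) * w' * poly (jacobi_rec n \<alpha>) z
        + poly (pderiv (jacobi_rec n \<alpha>)) z * ?w z)"
    using DERIV_imp_deriv by simp
  define p q r where "p = poly (jacobi_rec n \<alpha>) z" and "q = poly (pderiv (jacobi_rec n \<alpha>)) z"
    and "r = poly (jacobi_rec (Suc n) \<alpha>) z"
  have r: "of_nat (Suc n) * r = (\<alpha> + of_nat (Suc n) * z) * p - (1 - z\<^sup>2) * q"
    unfolding r_def p_def q_def using of_nat_neq_0[of n, where ?'a = complex]
    by (simp add: power2_eq_square field_simps del: of_nat_Suc)
  have "(deriv ^^ Suc n) (?W (Suc n)) z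
    = 2 * (1 - z\<^sup>2) * (?K * ((- \<alpha> * (1 - z) - \<alpha> * (1 + z)) * w' * p + q * ?w z))
      + (2 * \<alpha> - 2 * of_nat (Suc n) * z) * (?K * (?w z * p))"
    using rodrigues_weight_step[OF Suc.prems, of n \<alpha>] Suc.IH[OF Suc.prems] d
    unfolding p_def q_def by (simp add: mult_ac del: funpow.simps)
  also have "\<dots> = 2 * ?K * ((1 - z\<^sup>2) * w' * (- 2 * \<alpha> * p) + ?w z * ((1 - z\<^sup>2) * q + (\<alpha> - of_nat (Suc n) * z) * p))"
    by algebra
  also have "\<dots> = - 2 * ?K * ?w z * (of_nat (Suc n) * r)"
    unfolding w r by algebra
  finally show ?case
    by (simp add: r_def mult_ac)
qed simp

text \<open>Existence is \<open>rodrigues_jacobi_rec\<close>; uniqueness holds because two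
  polynomials that agree on the infinite unit disc coincide.\<close>

lemma Jacobi_poly_eq_jacobi_rec: "Jacobi_poly n \<alpha> (- \<alpha>) = jacobi_rec n \<alpha>"
  unfolding Jacobi_poly_def
proof (rule the_equality)
  let ?R = "\<lambda>z. (-1) ^ n / (2 ^ n * fact n) * (1 - z) powr (- \<alpha>) * (1 + z) powr (- (- \<alpha>)) *
       (deriv ^^ n) (\<lambda>w. (1 - w) powr (\<alpha> + of_nat n) * (1 + w) powr (- \<alpha> + of_nat n)) z"
  have eq: "poly (jacobi_rec n \<alpha>) z = ?R z" if "norm z < 1" for z
  proof -
    have nz: "1 - z \<noteq> 0" "1 + z \<noteq> 0"
      using one_plus_minus_nonpos[OF that] by auto
    have "?R z = ((-1) ^ n * (-2) ^ n / 2 ^ n) * ((1 - z) powr (- \<alpha>) * (1 - z) powr \<alpha>)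
        * ((1 + z) powr \<alpha> * (1 + z) powr (- \<alpha>)) * poly (jacobi_rec n \<alpha>) z"
      by (subst rodrigues_jacobi_rec[OF that]) simp
    also have "(-1) ^ n * (-2) ^ n / 2 ^ n = (1 :: complex)"
      by (simp flip: power_mult_distrib)
    finally show ?thesis
      using nz by (simp add: powr_minus)
  qed
  then show "\<forall>z. norm z < 1 \<longrightarrow> poly (jacobi_rec n \<alpha>) z = ?R z"
    by blast
  fix p
  assume p: "\<forall>z. norm z < 1 \<longrightarrow> poly p z = ?R z"
  have "poly (p - jacobi_rec n \<alpha>) z = 0" if "norm z < 1" for z
    using p eq that by simp
  then have "ball 0 1 \<subseteq> {z. poly (p - jacobi_rec n \<alpha>) z = 0}"
    by auto
  moreover have "infinite (ball (0 :: complex) 1)"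
    using uncountable_ball[of 1] countable_finite by auto
  ultimately show "p = jacobi_rec n \<alpha>"
    using poly_roots_finite infinite_super by (metis eq_iff_diff_eq_0)
qed

section \<open>The substitution z = i cot t\<close>

lemma i_cot_derivative:
  fixes t :: complex
  assumes "sin t \<noteq> 0"
  shows "((\<lambda>t. \<i> * cot t) has_field_derivative - \<i> * (1 - (\<i> * cot t)\<^sup>2)) (at t)"
proof -
  \<comment> \<open>The derivative is to be expressed through z = i cot t itself, so that the chain
    rule produces the factor 1 - z^2 of the Jacobi recurrence.\<close>
  have "1 / (sin t)\<^sup>2 = 1 + (cot t)\<^sup>2"
    using assms sin_cos_squared_add[of t] by (simp add: cot_def field_simps)
  then have "inverse ((sin t)\<^sup>2) = 1 - (\<i> * cot t)\<^sup>2"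
    by (simp add: power_mult_distrib inverse_eq_divide)
  then show ?thesis
    using DERIV_cmult[OF DERIV_cot[OF assms], of \<i>] by (simp add: algebra_simps)
qed

text \<open>The function inside the braces of the two formulas. The variable t is complex so that
  complex derivatives are available, and a comes last so that \<open>even_part\<close> and
  \<open>odd_part\<close> apply directly.\<close>

definition twisted_jacobi :: "nat \<Rightarrow> complex \<Rightarrow> complex \<Rightarrow> complex" where
  "twisted_jacobi n t a = exp (\<i> * a * t) * poly (Jacobi_poly n a (- a)) (\<i> * cot t)"

lemma twisted_jacobi_0: "twisted_jacobi 0 t a = exp (\<i> * a * t)"
  by (simp add: twisted_jacobi_def Jacobi_poly_eq_jacobi_rec)

text \<open>The term i a from the exponential is exactly what the constant term a of the Jacobi
  recurrence contributes, so no explicit a is left over.\<close>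

lemma twisted_jacobi_derivative:
  assumes "sin t \<noteq> 0"
  shows "((\<lambda>t. twisted_jacobi n t a) has_field_derivative
    of_nat (Suc n) * (cot t * twisted_jacobi n t a + \<i> * twisted_jacobi (Suc n) t a)) (at t)"
proof -
  define p q where "p = poly (jacobi_rec n a) (\<i> * cot t)" and "q = poly (pderiv (jacobi_rec n a)) (\<i> * cot t)"
  have "((\<lambda>t. exp (\<i> * a * t) * poly (jacobi_rec n a) (\<i> * cot t)) has_field_derivative
     (exp (\<i> * a * t) * (\<i> * a)) * poly (jacobi_rec n a) (\<i> * cot t)
     + (q * (- \<i> * (1 - (\<i> * cot t)\<^sup>2))) * exp (\<i> * a * t)) (at t)"
    unfolding q_def
    by (intro DERIV_mult DERIV_chain2[OF poly_DERIV i_cot_derivative[OF assms]])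
      (auto intro!: derivative_eq_intros)
  moreover have "(exp (\<i> * a * t) * (\<i> * a)) * poly (jacobi_rec n a) (\<i> * cot t)
     + (q * (- \<i> * (1 - (\<i> * cot t)\<^sup>2))) * exp (\<i> * a * t)
     = of_nat (Suc n) * (cot t * twisted_jacobi n t a + \<i> * twisted_jacobi (Suc n) t a)"
  proof -
    have "of_nat (Suc n) * poly (jacobi_rec (Suc n) a) (\<i> * cot t)
      = (a + of_nat (Suc n) * (\<i> * cot t)) * p - (1 - (\<i> * cot t)\<^sup>2) * q"
      unfolding p_def q_def using of_nat_neq_0[of n, where ?'a = complex]
      by (simp add: power2_eq_square field_simps del: of_nat_Suc)
    then have "of_nat (Suc n) * twisted_jacobi (Suc n) t a
      = exp (\<i> * a * t) * ((a + of_nat (Suc n) * (\<i> * cot t)) * p - (1 - (\<i> * cot t)\<^sup>2) * q)"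
      unfolding twisted_jacobi_def Jacobi_poly_eq_jacobi_rec by algebra
    moreover have "twisted_jacobi n t a = exp (\<i> * a * t) * p"
      by (simp add: twisted_jacobi_def Jacobi_poly_eq_jacobi_rec p_def)
    moreover have "\<i> * \<i> = (-1 :: complex)"
      by simp
    ultimately show ?thesis
      unfolding p_def[symmetric] by algebra
  qed
  ultimately show ?thesis
    by (simp add: twisted_jacobi_def Jacobi_poly_eq_jacobi_rec)
qed

subsection \<open>The ladder in the order\<close>

text \<open>The power rule in logarithmic form: no exponent m - 1 appears, so the full power can be
  factored out of long products, also when m = 0.\<close>

lemma has_field_derivative_power_log:
  fixes f :: "complex \<Rightarrow> complex"
  assumes "(f has_field_derivative D) (at z)" "f z \<noteq> 0"
  shows "((\<lambda>w. f w ^ m) has_field_derivative of_nat m * (D / f z) * f z ^ m) (at z)"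
proof (cases m)
  case (Suc k)
  have "((\<lambda>w. f w ^ m) has_field_derivative of_nat m * (D * f z ^ (m - Suc 0))) (at z)"
    by (rule DERIV_power[OF assms(1)])
  moreover have "of_nat m * (D * f z ^ (m - Suc 0)) = of_nat m * (D / f z) * f z ^ m"
    using assms(2) Suc by simp
  ultimately show ?thesis
    by simp
qed simp

lemma half_add_of_int_notin_Ints: "(1 / 2 :: complex) + of_int k \<notin> \<int>"
proof
  assume "(1 / 2 :: complex) + of_int k \<in> \<int>"
  then obtain j where "(1 / 2 :: complex) + of_int k = of_int j"
    by (elim Ints_cases)
  then have "(1 :: complex) = of_int (2 * (j - k))"
    by (simp add: field_simps)
  then have "1 = 2 * (j - k)"
    by (metis of_int_1 of_int_eq_iff)
  then show False
    by presburger
qed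

lemma nonpos_Ints_half:
  "(1 / 2 - of_nat m :: complex) \<notin> \<int>\<^sub>\<le>\<^sub>0" "(1 / 2 + of_nat m :: complex) \<notin> \<int>\<^sub>\<le>\<^sub>0"
  "(3 / 2 + of_nat m :: complex) \<notin> \<int>\<^sub>\<le>\<^sub>0"
proof -
  note * = half_add_of_int_notin_Ints
  show "(1 / 2 - of_nat m :: complex) \<notin> \<int>\<^sub>\<le>\<^sub>0" "(1 / 2 + of_nat m :: complex) \<notin> \<int>\<^sub>\<le>\<^sub>0"
    using *[of "- int m"] *[of "int m"] nonpos_Ints_subset_Ints by auto
  have "(3 / 2 + of_nat m :: complex) = 1 / 2 + of_int (int (Suc m))"
    by simp
  then show "(3 / 2 + of_nat m :: complex) \<notin> \<int>\<^sub>\<le>\<^sub>0"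
    using *[of "int (Suc m)"] nonpos_Ints_subset_Ints by (metis subsetD)
qed

lemma half_angle_nonzero:
  assumes "0 < r" "r < pi"
  shows "sin (of_real r / 2 :: complex) \<noteq> 0" "cos (of_real r / 2 :: complex) \<noteq> 0"
    "sin (of_real r :: complex) \<noteq> 0" "norm ((sin (of_real r / 2 :: complex))\<^sup>2) < 1"
proof -
  have "sin (r / 2) > 0" "cos (r / 2) > 0" "sin r > 0"
    using assms by (auto intro!: sin_gt_zero cos_gt_zero)
  moreover have "sin (of_real r / 2 :: complex) = of_real (sin (r / 2))"
    "cos (of_real r / 2 :: complex) = of_real (cos (r / 2))"
    "sin (of_real r :: complex) = of_real (sin r)"
    by (simp_all flip: sin_of_real cos_of_real)
  moreover have "(sin (r / 2))\<^sup>2 < 1"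
    using \<open>cos (r / 2) > 0\<close> sin_cos_squared_add[of "r / 2"]
    by (smt (verit) zero_less_power)
  ultimately show "sin (of_real r / 2 :: complex) \<noteq> 0" "cos (of_real r / 2 :: complex) \<noteq> 0"
    "sin (of_real r :: complex) \<noteq> 0" "norm ((sin (of_real r / 2 :: complex))\<^sup>2) < 1"
    by (simp_all add: norm_power)
qed

section \<open>The case m = 0: Gauss series as exponentials\<close>

lemma has_field_derivative_gauss_2F1_sin_squared:
  assumes "norm ((sin z)\<^sup>2) < 1"
  shows "((\<lambda>z. gauss_2F1 a b c ((sin z)\<^sup>2)) has_field_derivative
    gauss_2F1_deriv a b c ((sin z)\<^sup>2) * (2 * sin z * cos z)) (at z)"
  by (rule DERIV_chain2[where f = "gauss_2F1 a b c" and g = "\<lambda>z. (sin z)\<^sup>2",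
        OF has_field_derivative_gauss_2F1[OF assms]])
    (auto intro!: derivative_eq_intros)

text \<open>The two contiguous relations say that the left-hand side is an eigenfunction of
  \<open>d/dt\<close> with eigenvalue \<open>2\<i>\<alpha>\<close>.\<close>
lemma gauss_2F1_exp:
  assumes "0 \<le> t" "t < pi / 2"
  shows "cos (of_real t) * gauss_2F1 (1 / 2 - \<alpha>) (1 / 2 + \<alpha>) (1 / 2) ((sin (of_real t))\<^sup>2)
    + \<i> * \<alpha> * (2 * sin (of_real t) * gauss_2F1 (1 / 2 - \<alpha>) (1 / 2 + \<alpha>) (3 / 2) ((sin (of_real t))\<^sup>2))
    = exp (2 * \<i> * \<alpha> * of_real t)"
proof -
  let ?F = "gauss_2F1 (1 / 2 - \<alpha>) (1 / 2 + \<alpha>)"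
  let ?D = "gauss_2F1_deriv (1 / 2 - \<alpha>) (1 / 2 + \<alpha>)"
  define u where "u z = cos z * ?F (1 / 2) ((sin z)\<^sup>2) + \<i> * \<alpha> * (2 * sin z * ?F (3 / 2) ((sin z)\<^sup>2))" for z
  \<comment> \<open>The argument stays on this real segment, where |sin z|^2 < 1 keeps the series
    convergent; convexity turns the zero derivative into a constant.\<close>
  let ?S = "of_real ` {0..<pi / 2} :: complex set"
  have "((\<lambda>z. u z * exp (- (2 * \<i> * \<alpha> * z))) has_field_derivative 0) (at z within ?S)" if "z \<in> ?S" for z
  proof -
    from that obtain r where r: "0 \<le> r" "r < pi / 2" and z: "z = of_real r"
      by auto
    have "cos r > 0"
      using r by (intro cos_gt_zero_pi) auto
    then have "(sin r)\<^sup>2 < 1"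
      using sin_cos_squared_add[of r] by (smt (verit) zero_less_power)
    then have n: "norm ((sin z)\<^sup>2) < 1"
      unfolding z by (simp add: norm_power sin_of_real)
    define s c F H F' H' where "s = sin z" and "c = cos z" and "F = ?F (1 / 2) (s\<^sup>2)"
      and "H = ?F (3 / 2) (s\<^sup>2)" and "F' = ?D (1 / 2) (s\<^sup>2)" and "H' = ?D (3 / 2) (s\<^sup>2)"
    have cs: "c\<^sup>2 = 1 - s\<^sup>2"
      unfolding c_def s_def by (rule cos_squared_eq)
    have 1: "F = H + 2 * s\<^sup>2 * H'"
      using gauss_2F1_lower[of "s\<^sup>2" "1 / 2" "1 / 2 - \<alpha>" "1 / 2 + \<alpha>"] n nonpos_Ints_half(3)[of 0]
      unfolding F_def H_def H'_def s_def by (simp add: field_simps)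
    \<comment> \<open>At c = 1/2 one has c - a = \<alpha>, c - b = -\<alpha> and c - a - b =
      -1/2.\<close>
    have 2: "(1 - s\<^sup>2) * F' - F / 2 = - 2 * \<alpha>\<^sup>2 * H"
      using gauss_2F1_raise[of "s\<^sup>2" "1 / 2" "1 / 2 - \<alpha>" "1 / 2 + \<alpha>"] n nonpos_Ints_half(2)[of 0]
      unfolding F_def H_def F'_def s_def by (simp add: field_simps power2_eq_square)
    have "(u has_field_derivative ((- s) * F + (F' * (2 * s * c)) * c)
        + \<i> * \<alpha> * ((2 * c) * H + (H' * (2 * s * c)) * (2 * s))) (at z)"
      unfolding u_def[abs_def] s_def c_def F_def H_def F'_def H'_def
      by (intro DERIV_add DERIV_mult DERIV_cmult has_field_derivative_gauss_2F1_sin_squared[OF n]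
          DERIV_sin DERIV_cos)
    moreover have "((- s) * F + (F' * (2 * s * c)) * c)
        + \<i> * \<alpha> * ((2 * c) * H + (H' * (2 * s * c)) * (2 * s)) = 2 * \<i> * \<alpha> * u z"
    proof -
      have "(- s) * F + (F' * (2 * s * c)) * c = 2 * s * ((1 - s\<^sup>2) * F' - F / 2)"
        unfolding cs[symmetric] by (simp add: field_simps power2_eq_square)
      moreover have "(2 * c) * H + (H' * (2 * s * c)) * (2 * s) = 2 * c * F"
        unfolding 1 by (simp add: field_simps power2_eq_square)
      moreover have "u z = c * F + \<i> * \<alpha> * (2 * s * H)"
        by (simp add: u_def c_def s_def F_def H_def)
      moreover have "\<i> * \<i> = (-1 :: complex)"
        by simp
      ultimately show ?thesis
        unfolding 2 by algebra
    qed
    ultimately have du: "(u has_field_derivative 2 * \<i> * \<alpha> * u z) (at z)"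
      by simp
    have "((\<lambda>z. u z * exp (- (2 * \<i> * \<alpha> * z))) has_field_derivative
      (2 * \<i> * \<alpha> * u z) * exp (- (2 * \<i> * \<alpha> * z))
      + (exp (- (2 * \<i> * \<alpha> * z)) * (- (2 * \<i> * \<alpha>))) * u z) (at z)"
      by (intro DERIV_mult du) (auto intro!: derivative_eq_intros)
    then show ?thesis
      by (simp add: algebra_simps has_field_derivative_at_within)
  qed
  moreover have "convex ?S"
    by (intro convex_linear_image bounded_linear.linear[OF bounded_linear_of_real]) simp
  ultimately obtain k where k: "\<And>z. z \<in> ?S \<Longrightarrow> u z * exp (- (2 * \<i> * \<alpha> * z)) = k"
    using has_field_derivative_zero_constant[of ?S "\<lambda>z. u z * exp (- (2 * \<i> * \<alpha> * z))"] by blast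
  \<comment> \<open>At 0 the sine removes the second summand and the Gauss series in the first
    equals 1.\<close>
  have "k = 1"
    using k[of 0] by (force simp: u_def)
  then have "u (of_real t) * exp (- (2 * \<i> * \<alpha> * of_real t)) = 1"
    using k[of "of_real t"] assms by auto
  then show ?thesis
    unfolding u_def by (simp add: exp_minus field_simps)
qed

lemma gauss_2F1_swap: "gauss_2F1 a b c z = gauss_2F1 b a c z"
  by (simp add: gauss_2F1_def eval_fps_def mult.commute)

text \<open>Up to the factor \<open>sqrt 2\<close>, these are \<open>(sin t)\<^sup>1\<^sup>/\<^sup>2\<close> times the Ferrers functions of order
  \<open>1/2 + m\<close> and (cleared of its denominator) \<open>-(1/2 + m)\<close>.\<close>
definition ladder_plus :: "complex \<Rightarrow> nat \<Rightarrow> complex \<Rightarrow> complex" where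
  "ladder_plus \<alpha> m t = rGamma (1 / 2 - of_nat m) * (cos (t / 2) ^ Suc m * inverse (sin (t / 2)) ^ m *
     gauss_2F1 (1 / 2 - \<alpha>) (1 / 2 + \<alpha>) (1 / 2 - of_nat m) ((sin (t / 2))\<^sup>2))"

definition ladder_minus :: "complex \<Rightarrow> nat \<Rightarrow> complex \<Rightarrow> complex" where
  "ladder_minus \<alpha> m t = pochhammer (\<alpha> - of_nat m) (2 * m + 1) * rGamma (3 / 2 + of_nat m) *
     (sin (t / 2) ^ Suc m * inverse (cos (t / 2)) ^ m *
     gauss_2F1 (1 / 2 - \<alpha>) (1 / 2 + \<alpha>) (3 / 2 + of_nat m) ((sin (t / 2))\<^sup>2))"

section \<open>Differential relations between neighbouring orders\<close>

lemma half_sin_cos_derivative: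
  "((\<lambda>t. sin (t / 2)) has_field_derivative cos (t / 2) / 2) (at t)"
  "((\<lambda>t. cos (t / 2)) has_field_derivative - sin (t / 2) / 2) (at t)" for t :: complex
  by (auto intro!: derivative_eq_intros)

lemma cot_half_angle:
  fixes t :: complex
  shows "cot t = ((cos (t / 2))\<^sup>2 - (sin (t / 2))\<^sup>2) / (2 * sin (t / 2) * cos (t / 2))"
  using sin_double[of "t / 2"] cos_double[of "t / 2"] by (simp add: cot_def)

text \<open>Lowering the third parameter to -1/2 - m by \<open>gauss_2F1_lower\<close> trades the
  derivative of the Gauss series for the series of index m + 1. The factor -1/2 - m is absorbed by
  the recurrence of \<open>rGamma\<close>.\<close>

lemma ladder_plus_derivative:
  assumes "sin (t / 2) \<noteq> 0" "cos (t / 2) \<noteq> 0" "norm ((sin (t / 2))\<^sup>2) < 1"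
  shows "(ladder_plus \<alpha> m has_field_derivative
    of_nat (Suc m) * cot t * ladder_plus \<alpha> m t + ladder_plus \<alpha> (Suc m) t) (at t)"
proof -
  define K where "K = (rGamma (1 / 2 - of_nat m) :: complex)"
  define s c F F' F1 M where "s = sin (t / 2)" and "c = cos (t / 2)"
    and "F = gauss_2F1 (1 / 2 - \<alpha>) (1 / 2 + \<alpha>) (1 / 2 - of_nat m) (s\<^sup>2)"
    and "F' = gauss_2F1_deriv (1 / 2 - \<alpha>) (1 / 2 + \<alpha>) (1 / 2 - of_nat m) (s\<^sup>2)"
    and "F1 = gauss_2F1 (1 / 2 - \<alpha>) (1 / 2 + \<alpha>) (1 / 2 - of_nat (Suc m)) (s\<^sup>2)"
    and "M = (of_nat m :: complex)"
  have nz: "s \<noteq> 0" "c \<noteq> 0"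
    using assms by (simp_all add: s_def c_def)
  have dsi: "((\<lambda>t. inverse (sin (t / 2))) has_field_derivative - (inverse s * (c / 2) * inverse s)) (at t)"
    unfolding s_def c_def by (rule DERIV_inverse'[OF half_sin_cos_derivative(1) assms(1)])
  have dF: "((\<lambda>t. gauss_2F1 (1 / 2 - \<alpha>) (1 / 2 + \<alpha>) (1 / 2 - of_nat m) ((sin (t / 2))\<^sup>2))
      has_field_derivative (F' * (2 * s * c)) * (1 / 2)) (at t)"
    unfolding F'_def s_def c_def
    by (rule DERIV_chain2[where g = "\<lambda>t. t / 2"
          and f = "\<lambda>z. gauss_2F1 (1 / 2 - \<alpha>) (1 / 2 + \<alpha>) (1 / 2 - of_nat m) ((sin z)\<^sup>2)",
          OF has_field_derivative_gauss_2F1_sin_squared[OF assms(3)]])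
      (auto intro!: derivative_eq_intros)
  have "(ladder_plus \<alpha> m has_field_derivative
    K * (((of_nat (Suc m) * ((- s / 2) / c) * c ^ Suc m) * inverse s ^ m
      + (of_nat m * (- (inverse s * (c / 2) * inverse s) / inverse s) * inverse s ^ m) * c ^ Suc m) * F
      + (F' * (2 * s * c)) * (1 / 2) * (c ^ Suc m * inverse s ^ m))) (at t)"
    unfolding ladder_plus_def[abs_def] K_def[symmetric] F_def
    unfolding c_def s_def
    by (intro DERIV_cmult DERIV_mult has_field_derivative_power_log half_sin_cos_derivative
        dsi[unfolded s_def c_def] dF[unfolded s_def c_def] assms nonzero_imp_inverse_nonzero)
  moreover have "K * (((of_nat (Suc m) * ((- s / 2) / c) * c ^ Suc m) * inverse s ^ m
      + (of_nat m * (- (inverse s * (c / 2) * inverse s) / inverse s) * inverse s ^ m) * c ^ Suc m) * F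
      + (F' * (2 * s * c)) * (1 / 2) * (c ^ Suc m * inverse s ^ m))
    = of_nat (Suc m) * cot t * ladder_plus \<alpha> m t + ladder_plus \<alpha> (Suc m) t"
  proof -
    define A where "A = K * c ^ Suc m * inverse s ^ m"
    have e: "- 1 / 2 - M + 1 = 1 / 2 - of_nat m" "1 / 2 - of_nat (Suc m) = - 1 / 2 - M"
      by (simp_all add: M_def)
    have low: "(- 1 / 2 - M) * F1 = (- 1 / 2 - M) * F + s\<^sup>2 * F'"
    proof -
      have "1 / 2 - of_nat (Suc m) \<noteq> (0 :: complex)"
        using nonpos_Ints_half(1)[of "Suc m"] by force
      then show ?thesis
        using gauss_2F1_lower[of "s\<^sup>2" "- 1 / 2 - M" "1 / 2 - \<alpha>" "1 / 2 + \<alpha>"] assms(3)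
          nonpos_Ints_half(1)[of m]
        unfolding F_def F1_def F'_def s_def e by blast
    qed
    have K: "rGamma (1 / 2 - of_nat (Suc m)) = (- 1 / 2 - M) * K"
      using rGamma_plus1[of "- 1 / 2 - M"] unfolding e K_def by (rule sym)
    have P: "ladder_plus \<alpha> m t = A * F"
      by (simp add: ladder_plus_def A_def K_def F_def s_def c_def)
    have P1: "ladder_plus \<alpha> (Suc m) t = A * (c / s) * ((- 1 / 2 - M) * F1)"
      unfolding ladder_plus_def K by (simp add: A_def F1_def s_def c_def field_simps)
    have ct: "cot t = (c\<^sup>2 - s\<^sup>2) / (2 * s * c)"
      unfolding s_def c_def by (rule cot_half_angle)
    have "K * (((of_nat (Suc m) * ((- s / 2) / c) * c ^ Suc m) * inverse s ^ m
      + (of_nat m * (- (inverse s * (c / 2) * inverse s) / inverse s) * inverse s ^ m) * c ^ Suc m) * F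
      + (F' * (2 * s * c)) * (1 / 2) * (c ^ Suc m * inverse s ^ m))
      = A * (((M + 1) * ((- s / 2) / c) + M * (- (inverse s * (c / 2) * inverse s) / inverse s)) * F
        + F' * s * c)"
      unfolding A_def M_def by (simp add: algebra_simps)
    \<comment> \<open>The cotangent term is split off; what remains is c / s times the right-hand
      side of \<open>low\<close>.\<close>
    also have "((M + 1) * ((- s / 2) / c) + M * (- (inverse s * (c / 2) * inverse s) / inverse s)) * F
        + F' * s * c = (M + 1) * ((c\<^sup>2 - s\<^sup>2) / (2 * s * c)) * F + (c / s) * ((- 1 / 2 - M) * F + s\<^sup>2 * F')"
      using nz by (simp add: field_simps power2_eq_square)
    also have "A * \<dots> = (M + 1) * ((c\<^sup>2 - s\<^sup>2) / (2 * s * c)) * (A * F)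
        + A * (c / s) * ((- 1 / 2 - M) * F + s\<^sup>2 * F')"
      by (simp only: distrib_left mult_ac)
    also have "\<dots> = of_nat (Suc m) * cot t * ladder_plus \<alpha> m t + ladder_plus \<alpha> (Suc m) t"
      unfolding P P1 ct low by (simp add: M_def add.commute)
    finally show ?thesis .
  qed
  ultimately show ?thesis
    by simp
qed

text \<open>Raising the third parameter 3/2 + m by \<open>gauss_2F1_raise\<close> yields the factor
  (m + 1 + \<alpha>)(m + 1 - \<alpha>). Up to sign this is what the Pochhammer symbol gains from m
  to m + 1, and that sign is the minus in the relation. The remaining 3/2 + m goes into
  \<open>rGamma\<close>.\<close>

lemma ladder_minus_derivative:
  assumes "sin (t / 2) \<noteq> 0" "cos (t / 2) \<noteq> 0" "norm ((sin (t / 2))\<^sup>2) < 1"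
  shows "(ladder_minus \<alpha> m has_field_derivative
    of_nat (Suc m) * cot t * ladder_minus \<alpha> m t - ladder_minus \<alpha> (Suc m) t) (at t)"
proof -
  define K where "K = pochhammer (\<alpha> - of_nat m) (2 * m + 1) * (rGamma (3 / 2 + of_nat m) :: complex)"
  define s c F F' F1 M where "s = sin (t / 2)" and "c = cos (t / 2)"
    and "F = gauss_2F1 (1 / 2 - \<alpha>) (1 / 2 + \<alpha>) (3 / 2 + of_nat m) (s\<^sup>2)"
    and "F' = gauss_2F1_deriv (1 / 2 - \<alpha>) (1 / 2 + \<alpha>) (3 / 2 + of_nat m) (s\<^sup>2)"
    and "F1 = gauss_2F1 (1 / 2 - \<alpha>) (1 / 2 + \<alpha>) (3 / 2 + of_nat (Suc m)) (s\<^sup>2)"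
    and "M = (of_nat m :: complex)"
  have nz: "s \<noteq> 0" "c \<noteq> 0"
    using assms by (simp_all add: s_def c_def)
  have cs: "c\<^sup>2 = 1 - s\<^sup>2"
    unfolding c_def s_def by (rule cos_squared_eq)
  have dci: "((\<lambda>t. inverse (cos (t / 2))) has_field_derivative - (inverse c * (- s / 2) * inverse c)) (at t)"
    unfolding s_def c_def by (rule DERIV_inverse'[OF half_sin_cos_derivative(2) assms(2)])
  have dF: "((\<lambda>t. gauss_2F1 (1 / 2 - \<alpha>) (1 / 2 + \<alpha>) (3 / 2 + of_nat m) ((sin (t / 2))\<^sup>2))
      has_field_derivative (F' * (2 * s * c)) * (1 / 2)) (at t)"
    unfolding F'_def s_def c_def
    by (rule DERIV_chain2[where g = "\<lambda>t. t / 2"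
          and f = "\<lambda>z. gauss_2F1 (1 / 2 - \<alpha>) (1 / 2 + \<alpha>) (3 / 2 + of_nat m) ((sin z)\<^sup>2)",
          OF has_field_derivative_gauss_2F1_sin_squared[OF assms(3)]])
      (auto intro!: derivative_eq_intros)
  have "(ladder_minus \<alpha> m has_field_derivative
    K * (((of_nat (Suc m) * ((c / 2) / s) * s ^ Suc m) * inverse c ^ m
      + (of_nat m * (- (inverse c * (- s / 2) * inverse c) / inverse c) * inverse c ^ m) * s ^ Suc m) * F
      + (F' * (2 * s * c)) * (1 / 2) * (s ^ Suc m * inverse c ^ m))) (at t)"
    unfolding ladder_minus_def[abs_def] K_def[symmetric] F_def
    unfolding c_def s_def
    by (intro DERIV_cmult DERIV_mult has_field_derivative_power_log half_sin_cos_derivative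
        dci[unfolded s_def c_def] dF[unfolded s_def c_def] assms nonzero_imp_inverse_nonzero)
  moreover have "K * (((of_nat (Suc m) * ((c / 2) / s) * s ^ Suc m) * inverse c ^ m
      + (of_nat m * (- (inverse c * (- s / 2) * inverse c) / inverse c) * inverse c ^ m) * s ^ Suc m) * F
      + (F' * (2 * s * c)) * (1 / 2) * (s ^ Suc m * inverse c ^ m))
    = of_nat (Suc m) * cot t * ladder_minus \<alpha> m t - ladder_minus \<alpha> (Suc m) t"
  proof -
    define A where "A = K * s ^ Suc m * inverse c ^ m"
    have M0: "3 / 2 + M \<noteq> 0"
      using nonpos_Ints_half(3)[of m] by (auto simp: M_def)
    have raise: "(3 / 2 + M) * (c\<^sup>2 * F' + (1 / 2 + M) * F) = (M + 1 + \<alpha>) * (M + 1 - \<alpha>) * F1"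
      using gauss_2F1_raise[of "s\<^sup>2" "3 / 2 + M" "1 / 2 - \<alpha>" "1 / 2 + \<alpha>"] assms(3)
        nonpos_Ints_half(3)[of m]
      unfolding cs by (simp add: F_def F1_def F'_def M_def s_def algebra_simps)
    \<comment> \<open>The product gains one factor at each end: \<alpha> - m - 1 in front and
      \<alpha> + m + 1 at the back.\<close>
    have "pochhammer (\<alpha> - of_nat (Suc m)) (2 * Suc m + 1)
      = (\<alpha> - of_nat (Suc m)) * (pochhammer (\<alpha> - of_nat m) (2 * m + 1) * (\<alpha> - of_nat m + of_nat (2 * m + 1)))"
    proof -
      have "pochhammer (\<alpha> - of_nat (Suc m)) (Suc (Suc (2 * m + 1)))
        = (\<alpha> - of_nat (Suc m)) * pochhammer (\<alpha> - of_nat (Suc m) + 1) (Suc (2 * m + 1))"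
        by (rule pochhammer_rec)
      also have "\<alpha> - of_nat (Suc m) + 1 = \<alpha> - of_nat m"
        by simp
      finally show ?thesis
        by (simp add: pochhammer_Suc)
    qed
    then have po: "pochhammer (\<alpha> - of_nat (Suc m)) (2 * Suc m + 1)
      = - ((M + 1 + \<alpha>) * (M + 1 - \<alpha>)) * pochhammer (\<alpha> - of_nat m) (2 * m + 1)"
      by (simp add: M_def algebra_simps)
    have "(3 / 2 + M) * rGamma (3 / 2 + of_nat (Suc m)) = rGamma (3 / 2 + of_nat m)"
      using rGamma_plus1[of "3 / 2 + M"] by (simp add: M_def add_ac)
    then have Rg: "rGamma (3 / 2 + of_nat (Suc m)) = rGamma (3 / 2 + of_nat m) / (3 / 2 + M)"
      using M0 by (metis nonzero_mult_div_cancel_left)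
    have K: "pochhammer (\<alpha> - of_nat (Suc m)) (2 * Suc m + 1) * rGamma (3 / 2 + of_nat (Suc m))
        = - ((M + 1 + \<alpha>) * (M + 1 - \<alpha>)) * K / (3 / 2 + M)"
      unfolding po K_def Rg by (simp only: times_divide_eq_right mult_ac)
    have P: "ladder_minus \<alpha> m t = A * F"
      by (simp add: ladder_minus_def A_def K_def F_def s_def c_def)
    have "ladder_minus \<alpha> (Suc m) t = - ((M + 1 + \<alpha>) * (M + 1 - \<alpha>)) * K / (3 / 2 + M)
        * (s ^ Suc (Suc m) * inverse c ^ Suc m * F1)"
      unfolding ladder_minus_def K s_def c_def F1_def ..
    also have "\<dots> = - A * (s / c) * ((M + 1 + \<alpha>) * (M + 1 - \<alpha>) * F1 / (3 / 2 + M))"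
      by (simp only: A_def power_Suc divide_inverse mult_ac mult_minus_left mult_minus_right)
    finally have "ladder_minus \<alpha> (Suc m) t = - A * (s / c) * ((M + 1 + \<alpha>) * (M + 1 - \<alpha>) * F1 / (3 / 2 + M))" .
    then have P1: "ladder_minus \<alpha> (Suc m) t = - A * (s / c) * (c\<^sup>2 * F' + (1 / 2 + M) * F)"
      unfolding raise[symmetric] using M0 by simp
    have ct: "cot t = (c\<^sup>2 - s\<^sup>2) / (2 * s * c)"
      unfolding s_def c_def by (rule cot_half_angle)
    have "K * (((of_nat (Suc m) * ((c / 2) / s) * s ^ Suc m) * inverse c ^ m
      + (of_nat m * (- (inverse c * (- s / 2) * inverse c) / inverse c) * inverse c ^ m) * s ^ Suc m) * F
      + (F' * (2 * s * c)) * (1 / 2) * (s ^ Suc m * inverse c ^ m))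
      = A * (((M + 1) * ((c / 2) / s) + M * (- (inverse c * (- s / 2) * inverse c) / inverse c)) * F
        + F' * s * c)"
      unfolding A_def M_def by (simp add: algebra_simps)
    also have "((M + 1) * ((c / 2) / s) + M * (- (inverse c * (- s / 2) * inverse c) / inverse c)) * F
        + F' * s * c = (M + 1) * ((c\<^sup>2 - s\<^sup>2) / (2 * s * c)) * F + (s / c) * (c\<^sup>2 * F' + (1 / 2 + M) * F)"
      using nz by (simp add: field_simps power2_eq_square)
    also have "A * \<dots> = (M + 1) * ((c\<^sup>2 - s\<^sup>2) / (2 * s * c)) * (A * F)
        - (- A * (s / c) * (c\<^sup>2 * F' + (1 / 2 + M) * F))"
      by (simp only: distrib_left mult_ac mult_minus_left mult_minus_right minus_add_distrib diff_conv_add_uminus minus_minus)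
    also have "\<dots> = of_nat (Suc m) * cot t * ladder_minus \<alpha> m t - ladder_minus \<alpha> (Suc m) t"
      unfolding P P1 ct by (simp add: M_def add.commute)
    finally show ?thesis .
  qed
  ultimately show ?thesis
    by simp
qed

text \<open>Each relation determines the next function from the current one and its derivative, so
  proportionality at index 0 propagates. Every step contributes the factor i (n + 1) / \<epsilon>,
  and 1 / \<epsilon> = \<epsilon>; the signs \<epsilon> = 1 and \<epsilon> = -1 serve the two
  ladders.\<close>

lemma ladder_unique:
  fixes G E :: "nat \<Rightarrow> complex \<Rightarrow> complex" and \<epsilon> k :: complex
  assumes G: "\<And>n r. 0 < r \<Longrightarrow> r < pi \<Longrightarrow> (G n has_field_derivative
      of_nat (Suc n) * cot (of_real r) * G n (of_real r) + \<epsilon> * G (Suc n) (of_real r)) (at (of_real r))"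
    and E: "\<And>n r. 0 < r \<Longrightarrow> r < pi \<Longrightarrow> (E n has_field_derivative
      of_nat (Suc n) * (cot (of_real r) * E n (of_real r) + \<i> * E (Suc n) (of_real r))) (at (of_real r))"
    and 0: "\<And>r. 0 < r \<Longrightarrow> r < pi \<Longrightarrow> G 0 (of_real r) = k * E 0 (of_real r)"
    and \<epsilon>: "\<epsilon> * \<epsilon> = 1"
    and r: "0 < r" "r < pi"
  shows "G n (of_real r) = k * (\<epsilon> * \<i>) ^ n * fact n * E n (of_real r)"
  using r
proof (induction n arbitrary: r)
  case 0
  then show ?case
    using assms(3) by simp
next
  case (Suc n)
  let ?k = "k * (\<epsilon> * \<i>) ^ n * fact n"
  define C where "C = cot (complex_of_real r)"
  \<comment> \<open>The induction hypothesis is known at real points only, so both derivatives are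
    taken along the real axis and compared there.\<close>
  have "((\<lambda>r. ?k * E n (of_real r)) has_vector_derivative
      ?k * (of_nat (Suc n) * (C * E n (of_real r) + \<i> * E (Suc n) (of_real r)))) (at r)"
    unfolding C_def
    by (rule has_vector_derivative_real_field[of "\<lambda>z. ?k * E n z"])
      (intro DERIV_cmult E Suc.prems)
  then have "((\<lambda>r. G n (of_real r)) has_vector_derivative
      ?k * (of_nat (Suc n) * (C * E n (of_real r) + \<i> * E (Suc n) (of_real r)))) (at r)"
    by (rule has_vector_derivative_transform_within_open[of _ _ _ "{0<..<pi}"])
      (use Suc in auto)
  moreover have "((\<lambda>r. G n (of_real r)) has_vector_derivative
      of_nat (Suc n) * C * G n (of_real r) + \<epsilon> * G (Suc n) (of_real r)) (at r)"
    unfolding C_def by (rule has_vector_derivative_real_field) (intro G Suc.prems)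
  ultimately have "?k * (of_nat (Suc n) * (C * E n (of_real r) + \<i> * E (Suc n) (of_real r)))
      = of_nat (Suc n) * C * G n (of_real r) + \<epsilon> * G (Suc n) (of_real r)"
    by (rule vector_derivative_unique_at)
  then have "\<epsilon> * G (Suc n) (of_real r) = ?k * of_nat (Suc n) * \<i> * E (Suc n) (of_real r)"
    unfolding Suc.IH[OF Suc.prems] by (simp add: algebra_simps del: of_nat_Suc)
  then have "G (Suc n) (of_real r) = \<epsilon> * (?k * of_nat (Suc n) * \<i> * E (Suc n) (of_real r))"
    using \<epsilon> by (metis mult.assoc mult_1)
  then show ?case
    by (simp add: mult_ac)
qed

text \<open>Half the sum and half the difference of \<open>gauss_2F1_exp\<close> at \<alpha> and
  -\<alpha>; the values are cos (\<alpha> r) and i sin (\<alpha> r).\<close>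

lemma gauss_2F1_cos_sin:
  fixes \<alpha> :: complex
  assumes "0 < r" "r < pi"
  defines "F \<equiv> \<lambda>c. gauss_2F1 (1 / 2 - \<alpha>) (1 / 2 + \<alpha>) c ((sin (of_real r / 2))\<^sup>2)"
  shows "cos (of_real r / 2) * F (1 / 2) = 1 / 2 * (exp (\<i> * \<alpha> * of_real r) + exp (\<i> * (- \<alpha>) * of_real r))"
    "\<i> * \<alpha> * (2 * sin (of_real r / 2) * F (3 / 2))
      = 1 / 2 * (exp (\<i> * \<alpha> * of_real r) - exp (\<i> * (- \<alpha>) * of_real r))"
proof -
  define x y where "x = cos (of_real r / 2) * F (1 / 2)" and "y = \<i> * \<alpha> * (2 * sin (of_real r / 2) * F (3 / 2))"
  have t: "0 \<le> r / 2" "r / 2 < pi / 2"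
    using assms by auto
  have p: "exp (\<i> * \<alpha> * of_real r) = x + y"
    using gauss_2F1_exp[OF t, of \<alpha>] by (simp add: x_def y_def F_def mult_ac)
  \<comment> \<open>Changing the sign of \<alpha> swaps the two upper parameters, so F is unchanged
    and only y changes sign.\<close>
  have q: "exp (\<i> * (- \<alpha>) * of_real r) = x - y"
    using gauss_2F1_exp[OF t, of "- \<alpha>"]
    by (simp add: x_def y_def F_def gauss_2F1_swap[of "1 / 2 + \<alpha>"] mult_ac)
  show "cos (of_real r / 2) * F (1 / 2) = 1 / 2 * (exp (\<i> * \<alpha> * of_real r) + exp (\<i> * (- \<alpha>) * of_real r))"
    unfolding x_def[symmetric] p q by simp
  show "\<i> * \<alpha> * (2 * sin (of_real r / 2) * F (3 / 2))
      = 1 / 2 * (exp (\<i> * \<alpha> * of_real r) - exp (\<i> * (- \<alpha>) * of_real r))"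
    unfolding y_def[symmetric] p q by simp
qed

lemma rGamma_half: "rGamma (1 / 2 :: complex) = 1 / of_real (sqrt pi)"
  "rGamma (3 / 2 :: complex) = 2 / of_real (sqrt pi)"
proof -
  show 1: "rGamma (1 / 2 :: complex) = 1 / of_real (sqrt pi)"
    by (simp add: rGamma_inverse_Gamma Gamma_one_half_complex inverse_eq_divide)
  have "(1 / 2 :: complex) + 1 = 3 / 2"
    by simp
  then have "1 / 2 * rGamma (3 / 2 :: complex) = rGamma (1 / 2)"
    using rGamma_plus1[of "1 / 2 :: complex"] by metis
  then show "rGamma (3 / 2 :: complex) = 2 / of_real (sqrt pi)"
    using 1 by (simp add: field_simps)
qed

lemma ladder_plus_eq:
  assumes "0 < r" "r < pi"
  shows "ladder_plus \<alpha> m (of_real r)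
    = \<i> ^ m * fact m / of_real (sqrt pi) * even_part (twisted_jacobi m (of_real r)) \<alpha>"
proof -
  have "ladder_plus \<alpha> m (of_real r)
      = 1 / of_real (sqrt pi) * (1 * \<i>) ^ m * fact m * even_part (twisted_jacobi m (of_real r)) \<alpha>"
  proof (rule ladder_unique[where E = "\<lambda>n t. even_part (twisted_jacobi n t) \<alpha>"])
    fix r :: real and n :: nat
    assume r: "0 < r" "r < pi"
    note nz = half_angle_nonzero[OF r]
    show "(ladder_plus \<alpha> n has_field_derivative of_nat (Suc n) * cot (of_real r) * ladder_plus \<alpha> n (of_real r)
        + 1 * ladder_plus \<alpha> (Suc n) (of_real r)) (at (of_real r))"
      using ladder_plus_derivative[OF nz(1,2,4)] by simp
    have "((\<lambda>t. 1 / 2 * (twisted_jacobi n t \<alpha> + twisted_jacobi n t (- \<alpha>))) has_field_derivative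
        1 / 2 * (of_nat (Suc n) * (cot (of_real r) * twisted_jacobi n (of_real r) \<alpha> + \<i> * twisted_jacobi (Suc n) (of_real r) \<alpha>)
        + of_nat (Suc n) * (cot (of_real r) * twisted_jacobi n (of_real r) (- \<alpha>) + \<i> * twisted_jacobi (Suc n) (of_real r) (- \<alpha>))))
        (at (of_real r))"
      by (intro DERIV_cmult DERIV_add twisted_jacobi_derivative nz)
    then show "((\<lambda>t. even_part (twisted_jacobi n t) \<alpha>) has_field_derivative of_nat (Suc n) *
        (cot (of_real r) * even_part (twisted_jacobi n (of_real r)) \<alpha>
        + \<i> * even_part (twisted_jacobi (Suc n) (of_real r)) \<alpha>)) (at (of_real r))"
      unfolding even_part_def by (rule back_subst[of "\<lambda>D. (_ has_field_derivative D) _"]) algebra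
    define H where "H = gauss_2F1 (1 / 2 - \<alpha>) (1 / 2 + \<alpha>) (1 / 2) ((sin (of_real r / 2 :: complex))\<^sup>2)"
    have "ladder_plus \<alpha> 0 (of_real r) = 1 / of_real (sqrt pi) * (cos (of_real r / 2) * H)"
      by (simp add: ladder_plus_def rGamma_half H_def)
    also have "cos (of_real r / 2) * H = even_part (twisted_jacobi 0 (of_real r)) \<alpha>"
      unfolding H_def gauss_2F1_cos_sin(1)[OF r] by (simp only: even_part_def twisted_jacobi_0)
    finally show "ladder_plus \<alpha> 0 (of_real r) = 1 / of_real (sqrt pi) * even_part (twisted_jacobi 0 (of_real r)) \<alpha>" .
  qed (use assms in auto)
  then show ?thesis
    by simp
qed

text \<open>The ladder with \<epsilon> = -1. Its initial constant -i / sqrt pi compensates the i in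
  the sine identity and accounts for the exponent m + 1.\<close>

lemma ladder_minus_eq:
  assumes "0 < r" "r < pi"
  shows "ladder_minus \<alpha> m (of_real r)
    = (- \<i>) ^ (m + 1) * fact m / of_real (sqrt pi) * odd_part (twisted_jacobi m (of_real r)) \<alpha>"
proof -
  have "ladder_minus \<alpha> m (of_real r)
      = - \<i> / of_real (sqrt pi) * (- 1 * \<i>) ^ m * fact m * odd_part (twisted_jacobi m (of_real r)) \<alpha>"
  proof (rule ladder_unique[where E = "\<lambda>n t. odd_part (twisted_jacobi n t) \<alpha>"])
    fix r :: real and n :: nat
    assume r: "0 < r" "r < pi"
    note nz = half_angle_nonzero[OF r]
    show "(ladder_minus \<alpha> n has_field_derivative of_nat (Suc n) * cot (of_real r) * ladder_minus \<alpha> n (of_real r)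
        + - 1 * ladder_minus \<alpha> (Suc n) (of_real r)) (at (of_real r))"
      using ladder_minus_derivative[OF nz(1,2,4)] by simp
    have "((\<lambda>t. 1 / 2 * (twisted_jacobi n t \<alpha> - twisted_jacobi n t (- \<alpha>))) has_field_derivative
        1 / 2 * (of_nat (Suc n) * (cot (of_real r) * twisted_jacobi n (of_real r) \<alpha> + \<i> * twisted_jacobi (Suc n) (of_real r) \<alpha>)
        - of_nat (Suc n) * (cot (of_real r) * twisted_jacobi n (of_real r) (- \<alpha>) + \<i> * twisted_jacobi (Suc n) (of_real r) (- \<alpha>))))
        (at (of_real r))"
      by (intro DERIV_cmult DERIV_diff twisted_jacobi_derivative nz)
    then show "((\<lambda>t. odd_part (twisted_jacobi n t) \<alpha>) has_field_derivative of_nat (Suc n) *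
        (cot (of_real r) * odd_part (twisted_jacobi n (of_real r)) \<alpha>
        + \<i> * odd_part (twisted_jacobi (Suc n) (of_real r)) \<alpha>)) (at (of_real r))"
      unfolding odd_part_def by (rule back_subst[of "\<lambda>D. (_ has_field_derivative D) _"]) algebra
    define H where "H = gauss_2F1 (1 / 2 - \<alpha>) (1 / 2 + \<alpha>) (3 / 2) ((sin (of_real r / 2 :: complex))\<^sup>2)"
    have "ladder_minus \<alpha> 0 (of_real r) = - \<i> / of_real (sqrt pi) * (\<i> * \<alpha> * (2 * sin (of_real r / 2) * H))"
      by (simp add: ladder_minus_def rGamma_half H_def field_simps)
    also have "\<i> * \<alpha> * (2 * sin (of_real r / 2) * H) = odd_part (twisted_jacobi 0 (of_real r)) \<alpha>"
      unfolding H_def gauss_2F1_cos_sin(2)[OF r] by (simp only: odd_part_def twisted_jacobi_0)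
    finally show "ladder_minus \<alpha> 0 (of_real r) = - \<i> / of_real (sqrt pi) * odd_part (twisted_jacobi 0 (of_real r)) \<alpha>" .
  qed (use assms in auto)
  then show ?thesis
    by simp
qed

subsection \<open>Ferrers functions of half-odd order\<close>

text \<open>With s and c the sine and cosine of \<theta> / 2, the base is (c / s)^2. The square root
  of c / s is c / sqrt (s c), which brings in sin \<theta> = 2 s c.\<close>

lemma half_angle_powr:
  assumes "0 < \<theta>" "\<theta> < pi"
  shows "((1 + cos \<theta>) / (1 - cos \<theta>)) powr ((1 / 2 + real m) / 2)
      = sqrt 2 * sin \<theta> powr (- 1 / 2) * (cos (\<theta> / 2) ^ Suc m * inverse (sin (\<theta> / 2)) ^ m)" (is ?P)
    and "((1 + cos \<theta>) / (1 - cos \<theta>)) powr (- (1 / 2 + real m) / 2)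
      = sqrt 2 * sin \<theta> powr (- 1 / 2) * (sin (\<theta> / 2) ^ Suc m * inverse (cos (\<theta> / 2)) ^ m)" (is ?Q)
proof -
  define s c where "s = sin (\<theta> / 2)" and "c = cos (\<theta> / 2)"
  have pos: "s > 0" "c > 0"
    using assms by (auto simp: s_def c_def intro!: sin_gt_zero cos_gt_zero)
  have h: "1 + cos \<theta> = 2 * c\<^sup>2" "1 - cos \<theta> = 2 * s\<^sup>2" "sin \<theta> = 2 * s * c"
    using cos_double_cos[of "\<theta> / 2"] cos_double_sin[of "\<theta> / 2"] sin_double[of "\<theta> / 2"]
    by (simp_all add: s_def c_def)
  have q: "(1 + cos \<theta>) / (1 - cos \<theta>) = (c / s)\<^sup>2"
    unfolding h power_divide by simp
  have "(2 * s * c) powr (- (1 / 2)) = inverse (sqrt (2 * s * c))"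
    using pos by (simp only: powr_minus) (subst powr_half_sqrt, simp_all)
  then have S: "sin \<theta> powr (- 1 / 2) = 1 / sqrt (2 * s * c)"
    unfolding h by (simp add: inverse_eq_divide)
  have sq: "(x / y)\<^sup>2 powr (e / 2) = (x / y) powr e" if "x > 0" "y > 0" for x y e :: real
  proof -
    have "(x / y)\<^sup>2 powr (e / 2) = ((x / y) powr 2) powr (e / 2)"
      using that by (simp add: powr_numeral)
    then show ?thesis
      by (simp add: powr_powr)
  qed
  \<comment> \<open>Stated for arbitrary positive x and y, as it is used for both c / s and s /
    c.\<close>
  have key: "(x / y) powr (1 / 2 + real m) = sqrt 2 * (1 / sqrt (2 * x * y)) * (x ^ Suc m * inverse y ^ m)"
    if "x > 0" "y > 0" for x y :: real
  proof -
    have "(x / y) powr (1 / 2 + real m) = sqrt (x / y) * (x / y) ^ m"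
      using that by (simp add: powr_add powr_half_sqrt powr_realpow)
    also have "sqrt (x / y) = sqrt 2 * (1 / sqrt (2 * x * y)) * x"
    proof -
      define u v where "u = sqrt x" and "v = sqrt y"
      have uv: "x = u * u" "y = v * v" "u > 0" "v > 0"
        using that by (simp_all add: u_def v_def)
      have "sqrt (2 * x * y) = sqrt 2 * u * v" "sqrt (x / y) = u / v"
        by (simp_all add: u_def v_def real_sqrt_mult real_sqrt_divide)
      then show ?thesis
        using uv(3,4) by (simp add: uv(1))
    qed
    also have "(x / y) ^ m = x ^ m * inverse y ^ m"
      by (simp only: divide_inverse power_mult_distrib)
    finally show ?thesis
      by (simp only: power_Suc mult_ac)
  qed
  show ?P
    unfolding q S sq[OF pos(2,1)] key[OF pos(2,1)] s_def[symmetric] c_def[symmetric] by (simp only: mult_ac)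
  have "(c / s) powr (- (1 / 2 + real m)) = inverse (c / s) powr (1 / 2 + real m)"
    using pos by (subst powr_minus, subst inverse_powr) simp_all
  then have "(c / s)\<^sup>2 powr (- (1 / 2 + real m) / 2) = (s / c) powr (1 / 2 + real m)"
    unfolding sq[OF pos(2,1)] inverse_divide .
  then show ?Q
    unfolding q S key[OF pos] s_def[symmetric] c_def[symmetric] .
qed

lemma of_real_half_angle:
  "complex_of_real (sin (\<theta> / 2)) = sin (of_real \<theta> / 2)"
  "complex_of_real (cos (\<theta> / 2)) = cos (of_real \<theta> / 2)"
  "complex_of_real ((1 - cos \<theta>) / 2) = (sin (of_real \<theta> / 2))\<^sup>2"
proof -
  show 1: "complex_of_real (sin (\<theta> / 2)) = sin (of_real \<theta> / 2)"
    "complex_of_real (cos (\<theta> / 2)) = cos (of_real \<theta> / 2)"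
    by (simp_all flip: sin_of_real cos_of_real)
  have "(1 - cos \<theta>) / 2 = (sin (\<theta> / 2))\<^sup>2"
    using cos_double_sin[of "\<theta> / 2"] by simp
  then show "complex_of_real ((1 - cos \<theta>) / 2) = (sin (of_real \<theta> / 2))\<^sup>2"
    by (simp only: of_real_power 1)
qed

text \<open>Only unfolding, with (1 - cos \<theta>) / 2 = sin^2 (\<theta> / 2). The second identity
  carries the Pochhammer factor on the left, so it remains meaningful where that factor
  vanishes.\<close>

lemma Ferrers_P_half_odd:
  assumes "0 < \<theta>" "\<theta> < pi"
  shows "Ferrers_P (- 1 / 2 + \<alpha>) (1 / 2 + of_nat m) (cos \<theta>)
      = of_real (sqrt 2) * of_real (sin \<theta> powr (- 1 / 2)) * ladder_plus \<alpha> m (of_real \<theta>)"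
    and "pochhammer (\<alpha> - of_nat m) (2 * m + 1) * Ferrers_P (- 1 / 2 + \<alpha>) (- (1 / 2 + of_nat m)) (cos \<theta>)
      = of_real (sqrt 2) * of_real (sin \<theta> powr (- 1 / 2)) * ladder_minus \<alpha> m (of_real \<theta>)"
proof -
  have nonneg: "0 \<le> (1 + cos \<theta>) / (1 - cos \<theta>)"
    using cos_ge_minus_one[of \<theta>] cos_le_one[of \<theta>] by (intro divide_nonneg_nonneg) linarith+
  have "complex_of_real ((1 + cos \<theta>) / (1 - cos \<theta>)) powr ((1 / 2 + of_nat m) / 2)
      = of_real (((1 + cos \<theta>) / (1 - cos \<theta>)) powr ((1 / 2 + real m) / 2))"
    using powr_of_real[OF nonneg, of "(1 / 2 + real m) / 2"] by simp
  then have 1: "complex_of_real ((1 + cos \<theta>) / (1 - cos \<theta>)) powr ((1 / 2 + of_nat m) / 2)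
      = of_real (sqrt 2) * of_real (sin \<theta> powr (- 1 / 2))
        * (cos (of_real \<theta> / 2) ^ Suc m * inverse (sin (of_real \<theta> / 2)) ^ m)"
    unfolding half_angle_powr(1)[OF assms]
    by (simp only: of_real_mult of_real_power of_real_inverse of_real_half_angle)
  have "complex_of_real ((1 + cos \<theta>) / (1 - cos \<theta>)) powr (- (1 / 2 + of_nat m) / 2)
      = of_real (((1 + cos \<theta>) / (1 - cos \<theta>)) powr (- (1 / 2 + real m) / 2))"
    using powr_of_real[OF nonneg, of "- (1 / 2 + real m) / 2"] by simp
  then have 2: "complex_of_real ((1 + cos \<theta>) / (1 - cos \<theta>)) powr (- (1 / 2 + of_nat m) / 2)
      = of_real (sqrt 2) * of_real (sin \<theta> powr (- 1 / 2))
        * (sin (of_real \<theta> / 2) ^ Suc m * inverse (cos (of_real \<theta> / 2)) ^ m)"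
    unfolding half_angle_powr(2)[OF assms]
    by (simp only: of_real_mult of_real_power of_real_inverse of_real_half_angle)
  have e: "- (- 1 / 2 + \<alpha>) = 1 / 2 - \<alpha>" "- 1 / 2 + \<alpha> + 1 = 1 / 2 + \<alpha>"
    "1 - (1 / 2 + of_nat m) = 1 / 2 - (of_nat m :: complex)"
    "1 - - (1 / 2 + of_nat m) = 3 / 2 + (of_nat m :: complex)"
    by (simp_all add: algebra_simps)
  have g: "1 / Gamma w = rGamma w" for w :: complex
    by (simp add: rGamma_inverse_Gamma inverse_eq_divide)
  show "Ferrers_P (- 1 / 2 + \<alpha>) (1 / 2 + of_nat m) (cos \<theta>)
      = of_real (sqrt 2) * of_real (sin \<theta> powr (- 1 / 2)) * ladder_plus \<alpha> m (of_real \<theta>)"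
    unfolding Ferrers_P_def 1 e of_real_half_angle ladder_plus_def
    by (simp only: g mult_ac)
  show "pochhammer (\<alpha> - of_nat m) (2 * m + 1) * Ferrers_P (- 1 / 2 + \<alpha>) (- (1 / 2 + of_nat m)) (cos \<theta>)
      = of_real (sqrt 2) * of_real (sin \<theta> powr (- 1 / 2)) * ladder_minus \<alpha> m (of_real \<theta>)"
    unfolding Ferrers_P_def 2 e of_real_half_angle ladder_minus_def
    by (simp only: g mult_ac)
qed

section \<open>Continuity of Gauss's series in its upper parameters\<close>

lemma pochhammer_nonneg_real: "0 \<le> x \<Longrightarrow> 0 \<le> pochhammer x n" for x :: real
  by (induction n) (auto simp: pochhammer_Suc)

lemma norm_pochhammer_le:
  fixes a :: complex
  assumes "norm a \<le> R"
  shows "norm (pochhammer a n) \<le> pochhammer R n"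
proof (induction n)
  case (Suc n)
  have "0 \<le> R"
    using norm_ge_zero assms by (rule order_trans)
  moreover have "norm (a + of_nat n) \<le> R + of_nat n"
    using norm_triangle_ineq[of a "of_nat n"] assms by simp
  ultimately show ?case
    using Suc by (auto simp: pochhammer_Suc norm_mult intro!: mult_mono pochhammer_nonneg_real)
qed simp

text \<open>By the M-test: the series is dominated by the one with parameters \<open>R, R\<close>.\<close>
lemma continuous_on_gauss_2F1_params:
  fixes f g :: "complex \<Rightarrow> complex"
  assumes "continuous_on A f" "continuous_on A g" "\<And>a. a \<in> A \<Longrightarrow> norm (f a) \<le> R"
    "\<And>a. a \<in> A \<Longrightarrow> norm (g a) \<le> R" "norm z < 1"
  shows "continuous_on A (\<lambda>a. gauss_2F1 (f a) (g a) c z)"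
proof (rule uniform_limit_theorem)
  let ?t = "\<lambda>n a. fps_nth (fps_hypergeo [f a, g a] [c] 1) n * z ^ n"
  \<comment> \<open>The lower parameter is kept, so the denominators agree and only the upper
    Pochhammer symbols have to be compared.\<close>
  let ?M = "\<lambda>n. norm (fps_nth (fps_hypergeo [of_real R, of_real R] [c] 1) n * z ^ n)"
  show "uniform_limit A (\<lambda>N a. \<Sum>n<N. ?t n a) (\<lambda>a. gauss_2F1 (f a) (g a) c z) sequentially"
    unfolding gauss_2F1_def eval_fps_def
  proof (rule Weierstrass_m_test)
    show "summable ?M"
      by (rule norm_summable_fps[OF norm_less_fps_conv_radius_gauss[OF assms(5)]])
    fix n a
    assume a: "a \<in> A"
    have R: "0 \<le> R"
      using norm_ge_zero order_trans assms(3)[OF a] by blast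
    have "norm (pochhammer (of_real R :: complex) n) = pochhammer R n"
      using pochhammer_nonneg_real[OF R, of n] by (simp add: pochhammer_of_real)
    moreover have "norm (pochhammer (f a) n) * norm (pochhammer (g a) n) \<le> pochhammer R n * pochhammer R n"
      using assms(3,4)[OF a] R by (intro mult_mono norm_pochhammer_le pochhammer_nonneg_real) auto
    ultimately show "norm (?t n a) \<le> ?M n"
      by (simp add: norm_mult norm_divide divide_right_mono mult_right_mono)
  qed
  have "continuous_on A (\<lambda>a. pochhammer (h a) n)" if "continuous_on A h"
    for h :: "complex \<Rightarrow> complex" and n
    unfolding pochhammer_prod by (intro continuous_intros that)
  then have "continuous_on A (?t n)" for n
    unfolding fps_hypergeo_nth foldl.simps divide_inverse by (intro continuous_intros assms(1,2))
  then show "\<forall>\<^sub>F N in sequentially. continuous_on A (\<lambda>a. \<Sum>n<N. ?t n a)"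
    by (intro always_eventually allI continuous_on_sum)
qed simp

lemma isCont_gauss_2F1_half:
  assumes "norm z < 1"
  shows "isCont (\<lambda>a. gauss_2F1 (1 / 2 - a) (1 / 2 + a) c z) \<alpha>"
proof -
  have "continuous_on (ball \<alpha> 1) (\<lambda>a. gauss_2F1 (1 / 2 - a) (1 / 2 + a) c z)"
  proof (rule continuous_on_gauss_2F1_params[where R = "norm \<alpha> + 2"])
    fix a
    assume "a \<in> ball \<alpha> 1"
    then have "norm a \<le> norm \<alpha> + 1"
      using norm_triangle_ineq2[of a \<alpha>] by (simp add: dist_norm norm_minus_commute)
    then show "norm (1 / 2 - a) \<le> norm \<alpha> + 2" "norm (1 / 2 + a) \<le> norm \<alpha> + 2"
      using norm_triangle_ineq4[of "1 / 2" a] norm_triangle_ineq[of "1 / 2" a] by auto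
  qed (auto intro!: continuous_intros assms)
  then show ?thesis
    by (simp add: continuous_on_eq_continuous_at)
qed

section \<open>The gamma quotient and functions of the second kind\<close>

lemma eventually_not_Ints: "eventually (\<lambda>a. a \<notin> \<int>) (at \<alpha>)" for \<alpha> :: complex
proof -
  have "open (- (\<int> - {\<alpha>}))"
    by (intro open_Compl closed_subset_Ints) auto
  then have "eventually (\<lambda>a. a \<in> - (\<int> - {\<alpha>})) (nhds \<alpha>)"
    by (intro eventually_nhds_in_open) auto
  then show ?thesis
    unfolding eventually_at_filter
    by eventually_elim auto
qed

lemma Gamma_quotient_pochhammer:
  fixes a :: complex
  assumes "a \<notin> \<int>"
  shows "Gamma (a + of_nat m + 1) / Gamma (a - of_nat m) = pochhammer (a - of_nat m) (2 * m + 1)"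
proof -
  have "a - of_nat m \<notin> \<int>\<^sub>\<le>\<^sub>0"
    using assms nonpos_Ints_subset_Ints by (metis Ints_add Ints_of_nat diff_add_cancel subsetD)
  from pochhammer_Gamma[OF this, of "2 * m + 1"] show ?thesis
    by (simp add: algebra_simps)
qed

text \<open>Writing the degree as a - 1/2 turns the gamma arguments into a + m + 1 and a - m. A
  punctured neighbourhood of \<alpha> contains no integers, and there the quotient is the Pochhammer
  symbol or its reciprocal.\<close>

lemma tendsto_Gamma_quotient_iff:
  fixes \<alpha> L :: complex
  shows "((\<lambda>n. Gamma (n + (1 / 2 + of_nat m) + 1) / Gamma (n - (1 / 2 + of_nat m) + 1)) \<longlongrightarrow> L)
      (at (- 1 / 2 + \<alpha>)) \<longleftrightarrow> ((\<lambda>a. pochhammer (a - of_nat m) (2 * m + 1)) \<longlongrightarrow> L) (at \<alpha>)" (is ?P)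
    and "((\<lambda>n. Gamma (n + - (1 / 2 + of_nat m) + 1) / Gamma (n - - (1 / 2 + of_nat m) + 1)) \<longlongrightarrow> L)
      (at (- 1 / 2 + \<alpha>)) \<longleftrightarrow> ((\<lambda>a. 1 / pochhammer (a - of_nat m) (2 * m + 1)) \<longlongrightarrow> L) (at \<alpha>)" (is ?Q)
proof -
  have at: "at (- 1 / 2 + \<alpha>) = filtermap (\<lambda>a. a + - 1 / 2) (at \<alpha>)"
    using filtermap_at_shift[of "1 / 2" \<alpha>] by (simp add: add.commute)
  have e: "a + - 1 / 2 + (1 / 2 + of_nat m) + 1 = a + of_nat m + 1"
    "a + - 1 / 2 - (1 / 2 + of_nat m) + 1 = a - of_nat m"
    "a + - 1 / 2 + - (1 / 2 + of_nat m) + 1 = a - of_nat m"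
    "a + - 1 / 2 - - (1 / 2 + of_nat m) + 1 = a + of_nat m + 1" for a :: complex
    by (simp_all add: algebra_simps)
  show ?P
    unfolding at filterlim_filtermap e
    by (intro tendsto_cong eventually_mono[OF eventually_not_Ints] Gamma_quotient_pochhammer)
  have "eventually (\<lambda>a. Gamma (a - of_nat m) / Gamma (a + of_nat m + 1)
      = 1 / pochhammer (a - of_nat m) (2 * m + 1)) (at \<alpha>)"
    using eventually_not_Ints 
    by eventually_elim (subst Gamma_quotient_pochhammer[symmetric], assumption, simp)
  then show ?Q
    unfolding at filterlim_filtermap e by (rule tendsto_cong)
qed

lemma isCont_pochhammer_shift: "isCont (\<lambda>a. pochhammer (a - of_nat m) n) \<alpha>" for \<alpha> :: complex
  unfolding pochhammer_prod by (intro continuous_intros)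

lemma pochhammer_symmetric_eq_0_iff:
  "pochhammer (\<alpha> - of_nat m) (2 * m + 1) = 0 \<longleftrightarrow> \<alpha> \<in> of_int ` {- int m..int m}" for \<alpha> :: complex
proof
  assume "pochhammer (\<alpha> - of_nat m) (2 * m + 1) = 0"
  then obtain k where k: "k < 2 * m + 1" "\<alpha> - of_nat m = - of_nat k"
    by (auto simp: pochhammer_eq_0_iff)
  then have "\<alpha> = of_int (int m - int k)"
    by (simp add: algebra_simps)
  with k(1) show "\<alpha> \<in> of_int ` {- int m..int m}"
    by (intro image_eqI[of _ _ "int m - int k"]) auto
next
  assume "\<alpha> \<in> of_int ` {- int m..int m}"
  then obtain j where j: "- int m \<le> j" "j \<le> int m" "\<alpha> = of_int j"
    by auto
  then have "\<alpha> - of_nat m = - of_nat (nat (int m - j))"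
    by (simp add: of_nat_nat)
  moreover have "nat (int m - j) < 2 * m + 1"
    using j by auto
  ultimately show "pochhammer (\<alpha> - of_nat m) (2 * m + 1) = 0"
    by (auto simp: pochhammer_eq_0_iff)
qed

lemma pochhammer_symmetric_nonzero: "a \<notin> \<int> \<Longrightarrow> pochhammer (a - of_nat m) (2 * m + 1) \<noteq> 0"
  for a :: complex
  unfolding pochhammer_symmetric_eq_0_iff by auto

lemma tendsto_pochhammer_shift:
  "((\<lambda>a. pochhammer (a - of_nat m) n) \<longlongrightarrow> pochhammer (\<alpha> - of_nat m) n) (at \<alpha>)" for \<alpha> :: complex
  using isCont_pochhammer_shift by (simp add: isCont_def)

lemma half_odd_notin_Ints: "(1 / 2 + of_nat m :: complex) \<notin> \<int>"
  "- (1 / 2 + of_nat m :: complex) \<notin> \<int>"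
proof -
  show 1: "(1 / 2 + of_nat m :: complex) \<notin> \<int>"
    using half_add_of_int_notin_Ints[of "int m"] by simp
  then show "- (1 / 2 + of_nat m :: complex) \<notin> \<int>"
    by (metis Ints_minus minus_minus)
qed

lemma sin_cos_half_odd_pi:
  "sin ((1 / 2 + of_nat m) * of_real pi :: complex) = (- 1) ^ m"
  "cot ((1 / 2 + of_nat m) * of_real pi :: complex) = 0"
proof -
  have e: "(1 / 2 + of_nat m) * of_real pi = (of_real ((1 / 2 + real m) * pi) :: complex)"
    by simp
  have "sin ((1 / 2 + real m) * pi) = (- 1) ^ m"
    by (simp add: distrib_right sin_add)
  then show "sin ((1 / 2 + of_nat m) * of_real pi :: complex) = (- 1) ^ m"
    unfolding e sin_of_real by simp
  have "cos ((1 / 2 + real m) * pi) = 0"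
    by (simp add: distrib_right cos_add)
  then show "cot ((1 / 2 + of_nat m) * of_real pi :: complex) = 0"
    unfolding e cot_def cos_of_real by simp
qed

text \<open>Since cot (\<mu> \<pi>) = 0, only the term with the opposite order survives. The limit
  of the gamma quotient is the Pochhammer symbol for positive order and its reciprocal for negative
  order; the latter is finite exactly when the symbol does not vanish.\<close>

lemma Ferrers_Q_half_odd:
  "Ferrers_Q_defined (- 1 / 2 + \<alpha>) (1 / 2 + of_nat m)"
  "Ferrers_Q (- 1 / 2 + \<alpha>) (1 / 2 + of_nat m) x = - of_real pi / 2 * (- 1) ^ m
     * (pochhammer (\<alpha> - of_nat m) (2 * m + 1) * Ferrers_P (- 1 / 2 + \<alpha>) (- (1 / 2 + of_nat m)) x)"
  "Ferrers_Q_defined (- 1 / 2 + \<alpha>) (- (1 / 2 + of_nat m))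
     \<longleftrightarrow> pochhammer (\<alpha> - of_nat m) (2 * m + 1) \<noteq> 0"
  "pochhammer (\<alpha> - of_nat m) (2 * m + 1) \<noteq> 0 \<Longrightarrow>
    Ferrers_Q (- 1 / 2 + \<alpha>) (- (1 / 2 + of_nat m)) x = of_real pi / 2 * (- 1) ^ m
     * (Ferrers_P (- 1 / 2 + \<alpha>) (1 / 2 + of_nat m) x / pochhammer (\<alpha> - of_nat m) (2 * m + 1))"
proof -
  let ?D = "\<lambda>a :: complex. pochhammer (a - of_nat m) (2 * m + 1)"
  let ?\<nu> = "- 1 / 2 + \<alpha>" and ?\<mu> = "1 / 2 + of_nat m :: complex"
  have lim: "((\<lambda>n. Gamma (n + ?\<mu> + 1) / Gamma (n - ?\<mu> + 1)) \<longlongrightarrow> ?D \<alpha>) (at ?\<nu>)"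
    unfolding tendsto_Gamma_quotient_iff by (rule tendsto_pochhammer_shift)
  then show "Ferrers_Q_defined ?\<nu> ?\<mu>"
    unfolding Ferrers_Q_defined_def using half_odd_notin_Ints(1) by blast
  have inv: "(1 :: complex) / (- 1) ^ m = (- 1) ^ m"
    by (cases "even m") auto
  show "Ferrers_Q ?\<nu> ?\<mu> x = - of_real pi / 2 * (- 1) ^ m * (?D \<alpha> * Ferrers_P ?\<nu> (- ?\<mu>) x)"
    unfolding Ferrers_Q_def tendsto_Lim[OF at_neq_bot lim] sin_cos_half_odd_pi inv by simp
  show "Ferrers_Q_defined ?\<nu> (- ?\<mu>) \<longleftrightarrow> ?D \<alpha> \<noteq> 0"
  proof
    assume "Ferrers_Q_defined ?\<nu> (- ?\<mu>)"
    then obtain L where L: "((\<lambda>a. 1 / ?D a) \<longlongrightarrow> L) (at \<alpha>)"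
      unfolding Ferrers_Q_defined_def tendsto_Gamma_quotient_iff by blast
    \<comment> \<open>A finite limit L of the reciprocal would force
      \<open>?D \<alpha> * L = 1\<close>.\<close>
    have "((\<lambda>a. ?D a * (1 / ?D a)) \<longlongrightarrow> ?D \<alpha> * L) (at \<alpha>)"
      by (intro tendsto_mult tendsto_pochhammer_shift L)
    moreover have "eventually (\<lambda>a. ?D a * (1 / ?D a) = 1) (at \<alpha>)"
      using eventually_not_Ints
      by eventually_elim (simp add: pochhammer_symmetric_nonzero del: One_nat_def)
    ultimately have "((\<lambda>a. 1) \<longlongrightarrow> ?D \<alpha> * L) (at \<alpha>)"
      by (subst (asm) tendsto_cong)
    then have "?D \<alpha> * L = 1"
      by (simp add: tendsto_const_iff)
    then show "?D \<alpha> \<noteq> 0"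
      by auto
  next
    assume "?D \<alpha> \<noteq> 0"
    then have "((\<lambda>a. 1 / ?D a) \<longlongrightarrow> 1 / ?D \<alpha>) (at \<alpha>)"
      by (intro tendsto_divide tendsto_const tendsto_pochhammer_shift)
    then show "Ferrers_Q_defined ?\<nu> (- ?\<mu>)"
      unfolding Ferrers_Q_defined_def tendsto_Gamma_quotient_iff using half_odd_notin_Ints(2) by blast
  qed
  assume "?D \<alpha> \<noteq> 0"
  then have lim: "((\<lambda>n. Gamma (n + - ?\<mu> + 1) / Gamma (n - - ?\<mu> + 1)) \<longlongrightarrow> 1 / ?D \<alpha>) (at ?\<nu>)"
    unfolding tendsto_Gamma_quotient_iff by (intro tendsto_divide tendsto_const tendsto_pochhammer_shift)
  \<comment> \<open>The sine is odd, and its sign cancels the minus in the definition of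
    \<open>Ferrers_Q\<close>.\<close>
  have cs: "cot (- ?\<mu> * of_real pi) = 0" "sin (- ?\<mu> * of_real pi) = - ((- 1) ^ m)"
    using sin_cos_half_odd_pi[of m] by (simp_all only: mult_minus_left sin_minus cot_minus minus_zero)
  show "Ferrers_Q ?\<nu> (- ?\<mu>) x = of_real pi / 2 * (- 1) ^ m * (Ferrers_P ?\<nu> ?\<mu> x / ?D \<alpha>)"
    unfolding Ferrers_Q_def tendsto_Lim[OF at_neq_bot lim] cs minus_minus divide_minus_right inv
    by simp
qed

text \<open>The degree enters only through the upper parameters of the Gauss series.\<close>

lemma isCont_Ferrers_P_degree:
  assumes "0 < \<theta>" "\<theta> < pi"
  shows "isCont (\<lambda>a. Ferrers_P (- 1 / 2 + a) \<mu> (cos \<theta>)) \<alpha>"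
proof -
  have e: "- (- 1 / 2 + a) = 1 / 2 - a" "- 1 / 2 + a + 1 = 1 / 2 + a" for a :: complex
    by simp_all
  have "norm (of_real ((1 - cos \<theta>) / 2) :: complex) < 1"
    unfolding of_real_half_angle by (rule half_angle_nonzero[OF assms])
  then show ?thesis
    unfolding Ferrers_P_def e by (intro isCont_mult continuous_const isCont_gauss_2F1_half)
qed

theorem theorem8p5:
  fixes m :: nat and \<alpha> :: complex and \<theta> :: real
  assumes "0 < \<theta>" and "\<theta> < pi"
  defines "C \<equiv> (\<lambda>a. exp (\<i> * a * of_real \<theta>) * poly (Jacobi_poly m a (- a)) (\<i> * of_real (cot \<theta>)))"
    and "D \<equiv> (\<lambda>a::complex. pochhammer (a - of_nat m) (2 * m + 1))"
    and "S \<equiv> (of_real (sin \<theta> powr (- 1 / 2)) :: complex)"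
    and "\<nu> \<equiv> - 1 / 2 + \<alpha>"
    and "\<mu> \<equiv> (1 / 2 + of_nat m :: complex)"
  shows
    "Ferrers_P \<nu> \<mu> (cos \<theta>) =
       of_real (sqrt (2 / pi)) * fact m * \<i> ^ m * S * even_part C \<alpha>
   \<and> Ferrers_Q_defined \<nu> \<mu>
   \<and> Ferrers_Q \<nu> \<mu> (cos \<theta>) =
       of_real (sqrt (pi / 2)) * fact m * \<i> ^ (m + 1) * S * odd_part C \<alpha>
   \<and> (\<alpha> \<notin> of_int ` {- int m .. int m} \<longrightarrow>
        D \<alpha> \<noteq> 0
      \<and> Ferrers_P \<nu> (- \<mu>) (cos \<theta>) =
          of_real (sqrt (2 / pi)) * fact m * (\<i> powi (- int m - 1) / D \<alpha>) * S * odd_part C \<alpha>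
      \<and> Ferrers_Q_defined \<nu> (- \<mu>)
      \<and> Ferrers_Q \<nu> (- \<mu>) (cos \<theta>) =
          of_real (sqrt (pi / 2)) * fact m * (\<i> powi (- int m) / D \<alpha>) * S * even_part C \<alpha>)
   \<and> (\<alpha> \<in> of_int ` {- int m .. int m} \<longrightarrow>
        D \<alpha> = 0
      \<and> ((\<lambda>a. of_real (sqrt (2 / pi)) * fact m * (\<i> powi (- int m - 1) / D a) * S * odd_part C a)
           \<longlongrightarrow> Ferrers_P \<nu> (- \<mu>) (cos \<theta>)) (at \<alpha>)
      \<and> \<not> Ferrers_Q_defined \<nu> (- \<mu>))"
proof -
  note \<theta> = assms(1,2)
  have C: "C = twisted_jacobi m (of_real \<theta>)"
    unfolding C_def twisted_jacobi_def[abs_def] cot_of_real ..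
  have r1: "complex_of_real (sqrt (2 / pi)) = of_real (sqrt 2) / of_real (sqrt pi)"
    by (simp add: real_sqrt_divide)
  have r2: "of_real pi / 2 * complex_of_real (sqrt 2) / of_real (sqrt pi) = of_real (sqrt (pi / 2))"
  proof -
    have "pi / 2 * sqrt 2 / sqrt pi = sqrt (pi / 2)"
      by (simp add: real_sqrt_divide field_simps)
    then show ?thesis
      by (metis of_real_divide of_real_mult of_real_numeral)
  qed
  have i: "\<i> powi (- int m - 1) = (- \<i>) ^ (m + 1)" "\<i> powi (- int m) = (- \<i>) ^ m"
  proof -
    have *: "\<i> powi (- int k) = (- \<i>) ^ k" for k
      by (simp add: power_int_minus flip: power_inverse)
    show "\<i> powi (- int m) = (- \<i>) ^ m"
      by (rule *)
    show "\<i> powi (- int m - 1) = (- \<i>) ^ (m + 1)"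
      using *[of "m + 1"] by (simp only: of_nat_add of_nat_1 minus_add_distrib diff_conv_add_uminus)
  qed
  \<comment> \<open>These absorb the sign (-1)^m coming from 1 / sin (\<mu> \<pi>) into the powers
    of i.\<close>
  have sgn: "(- 1) ^ m * (- \<i>) ^ m = \<i> ^ m" "(- 1) ^ m * \<i> ^ m = (- \<i>) ^ m"
    by (simp_all flip: power_mult_distrib)
  have P: "Ferrers_P (- 1 / 2 + a) \<mu> (cos \<theta>)
      = of_real (sqrt (2 / pi)) * fact m * \<i> ^ m * S * even_part C a" for a
    unfolding \<mu>_def Ferrers_P_half_odd(1)[OF \<theta>] ladder_plus_eq[OF \<theta>] C r1 S_def by (simp add: mult_ac)
  \<comment> \<open>Valid for every a, also where \<open>D a = 0\<close>; the formula for order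
    -\<mu> follows by division, or by a limit.\<close>
  have DP: "D a * Ferrers_P (- 1 / 2 + a) (- \<mu>) (cos \<theta>)
      = of_real (sqrt (2 / pi)) * fact m * \<i> powi (- int m - 1) * S * odd_part C a" for a
    unfolding \<mu>_def D_def Ferrers_P_half_odd(2)[OF \<theta>] ladder_minus_eq[OF \<theta>] C r1 S_def i by (simp add: mult_ac)
  have P': "Ferrers_P (- 1 / 2 + a) (- \<mu>) (cos \<theta>)
      = of_real (sqrt (2 / pi)) * fact m * (\<i> powi (- int m - 1) / D a) * S * odd_part C a"
    if "D a \<noteq> 0" for a
    using DP[of a] that by (simp add: field_simps)
  have Q: "Ferrers_Q \<nu> \<mu> (cos \<theta>) = of_real (sqrt (pi / 2)) * fact m * \<i> ^ (m + 1) * S * odd_part C \<alpha>"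
  proof -
    have "Ferrers_Q \<nu> \<mu> (cos \<theta>) = - of_real pi / 2 * (- 1) ^ m * (D \<alpha> * Ferrers_P (- 1 / 2 + \<alpha>) (- \<mu>) (cos \<theta>))"
      unfolding \<nu>_def \<mu>_def D_def by (rule Ferrers_Q_half_odd(2))
    also have "\<dots> = (of_real pi / 2 * of_real (sqrt 2) / of_real (sqrt pi)) * fact m
        * (\<i> * ((- 1) ^ m * (- \<i>) ^ m)) * S * odd_part C \<alpha>"
      unfolding DP r1 i by (simp add: mult_ac)
    also have "\<dots> = of_real (sqrt (pi / 2)) * fact m * \<i> ^ (m + 1) * S * odd_part C \<alpha>"
      unfolding r2 sgn by simp
    finally show ?thesis .
  qed
  have Q': "Ferrers_Q \<nu> (- \<mu>) (cos \<theta>)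
      = of_real (sqrt (pi / 2)) * fact m * (\<i> powi (- int m) / D \<alpha>) * S * even_part C \<alpha>"
    if "D \<alpha> \<noteq> 0"
  proof -
    have "Ferrers_Q \<nu> (- \<mu>) (cos \<theta>) = of_real pi / 2 * (- 1) ^ m * (Ferrers_P (- 1 / 2 + \<alpha>) \<mu> (cos \<theta>) / D \<alpha>)"
      using that unfolding \<nu>_def \<mu>_def D_def by (rule Ferrers_Q_half_odd(4))
    also have "\<dots> = (of_real pi / 2 * of_real (sqrt 2) / of_real (sqrt pi)) * fact m
        * (((- 1) ^ m * \<i> ^ m) / D \<alpha>) * S * even_part C \<alpha>"
      unfolding P r1 by (simp add: mult_ac)
    also have "\<dots> = of_real (sqrt (pi / 2)) * fact m * (\<i> powi (- int m) / D \<alpha>) * S * even_part C \<alpha>"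
      unfolding r2 sgn i ..
    finally show ?thesis .
  qed
  have D0: "D \<alpha> = 0 \<longleftrightarrow> \<alpha> \<in> of_int ` {- int m..int m}"
    unfolding D_def by (rule pochhammer_symmetric_eq_0_iff)
  have Qd: "Ferrers_Q_defined \<nu> \<mu>" "Ferrers_Q_defined \<nu> (- \<mu>) \<longleftrightarrow> D \<alpha> \<noteq> 0"
    unfolding \<nu>_def \<mu>_def D_def by (rule Ferrers_Q_half_odd)+
  \<comment> \<open>Off the integers the right-hand side is the Ferrers function of degree a - 1/2,
    so continuity in the degree supplies the limit.\<close>
  have lim: "((\<lambda>a. of_real (sqrt (2 / pi)) * fact m * (\<i> powi (- int m - 1) / D a) * S * odd_part C a)
      \<longlongrightarrow> Ferrers_P \<nu> (- \<mu>) (cos \<theta>)) (at \<alpha>)"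
  proof (rule Lim_transform_eventually)
    show "((\<lambda>a. Ferrers_P (- 1 / 2 + a) (- \<mu>) (cos \<theta>)) \<longlongrightarrow> Ferrers_P \<nu> (- \<mu>) (cos \<theta>)) (at \<alpha>)"
      using isCont_Ferrers_P_degree[OF \<theta>] unfolding isCont_def \<nu>_def .
    show "eventually (\<lambda>a. Ferrers_P (- 1 / 2 + a) (- \<mu>) (cos \<theta>)
      = of_real (sqrt (2 / pi)) * fact m * (\<i> powi (- int m - 1) / D a) * S * odd_part C a) (at \<alpha>)"
      using eventually_not_Ints unfolding D_def
      by eventually_elim (rule P'[unfolded D_def], rule pochhammer_symmetric_nonzero)
  qed
  have nz: "D \<alpha> \<noteq> 0" if "\<alpha> \<notin> of_int ` {- int m..int m}"
    using D0 that by blast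
  have "\<not> Ferrers_Q_defined \<nu> (- \<mu>)" if "\<alpha> \<in> of_int ` {- int m..int m}"
    using D0 Qd(2) that by blast
  then show ?thesis
    by (intro conjI impI P[of \<alpha>, folded \<nu>_def] Qd(1) Q nz P'[OF nz, folded \<nu>_def]
        Qd(2)[THEN iffD2, OF nz] Q'[OF nz] D0[THEN iffD2] lim)
qed

end
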